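(* Let $\psi$ be a conformal map on the unit disk $\mathbb{D}$ with $\psi(0)=0$, and for $\alpha>0$ let $F_\alpha=\{z\in\mathbb{D}:|\psi(z)|=\alpha\}$ and let $N(\alpha)\in\mathbb{N}\cup\{+\infty\}$ denote the number of connected components of $F_\alpha$. If the limit $$L:=\lim_{\alpha\to+\infty}\frac{\log\left(\omega_{\mathbb{D}}(0,F_\alpha)^{-1}\right)}{\log\alpha}$$ exists in $[0,+\infty]$ and $$\lim_{\alpha\to+\infty}\frac{\log N(\alpha)}{\log\alpha}=0,$$ then the limit $$\mu:=\lim_{\alpha\to+\infty}\frac{d_{\mathbb{D}}(0,F_\alpha)}{\log\alpha}$$ exists in $[0,+\infty]$ and $\mu=L$.
   Context: A conformal map on $\mathbb{D}=\{z\in\mathbb{C}:|z|<1\}$ is an injective holomorphic function $\psi:\mathbb{D}\to\mathbb{C}$. Hyperbolic distance: for $z,w\in\mathbb{D}$, $d_{\mathbb{D}}(z,w)=\log\frac{1+\left|\frac{z-w}{1-z\bar w}\right|}{1-\left|\frac{z-w}{1-z\bar w}\right|}$; for a set $E\subset\mathbb{D}$, $d_{\mathbb{D}}(z,E)=\inf\{d_{\mathbb{D}}(z,w):w\in E\}$. Harmonic measure: for a domain $D$, $z\in D$ and a Borel set $E\subset\overline{D}$, $\omega_D(z,E)$ denotes the harmonic measure at $z$ of $E$ with respect to the component of $D\setminus E$ containing $z$; i.e. $\omega_D(\cdot,E)$ is the solution of the generalized Dirichlet problem in that component with boundary data $1_E$. Conventions: $\log(+\infty)=+\infty$ and $\log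 0=-\infty$, so the hypothesis on $N(\alpha)$ entails $1\le N(\alpha)<+\infty$ for all large $\alpha$. *)

theory Defs
  imports "HOL-Analysis.Analysis"
begin

definition conformal_map :: "(complex \<Rightarrow> complex) \<Rightarrow> bool" where
  "conformal_map \<psi> \<longleftrightarrow> \<psi> holomorphic_on ball 0 1 \<and> inj_on \<psi> (ball 0 1)"

definition level_set :: "(complex \<Rightarrow> complex) \<Rightarrow> real \<Rightarrow> complex set" where
  "level_set \<psi> \<alpha> = {z \<in> ball 0 1. cmod (\<psi> z) = \<alpha>}"

definition num_components :: "'a::topological_space set \<Rightarrow> enat" where
  "num_components S =
     (if finite (components S) then enat (card (components S)) else \<infinity>)"

text \<open>The logarithm on \<open>[0, \<infinity>]\<close>, with \<open>log 0 = -\<infinity>\<close> and \<open>log \<infinity> = \<infinity>\<close>.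
  Negative arguments do not occur.\<close>

definition ereal_ln :: "ereal \<Rightarrow> ereal" where
  "ereal_ln x =
     (if x \<le> 0 then -\<infinity> else if x = \<infinity> then \<infinity> else ereal (ln (real_of_ereal x)))"

definition hyp_dist :: "complex \<Rightarrow> complex \<Rightarrow> real" where
  "hyp_dist z w =
     ln ((1 + cmod ((z - w) / (1 - z * cnj w))) / (1 - cmod ((z - w) / (1 - z * cnj w))))"

text \<open>The infimum is taken in the extended reals; the distance to the empty set is \<open>\<infinity>\<close>.\<close>

definition hyp_setdist :: "complex \<Rightarrow> complex set \<Rightarrow> ereal" where
  "hyp_setdist z E = (INF w\<in>E. ereal (hyp_dist z w))"

text \<open>The mean of an extended real function over a circle, as the integral of the positive part
  minus the integral of the negative part (\<open>e2ennreal\<close> maps negative numbers to \<open>0\<close>). It is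
  only used for upper semicontinuous \<open>u < \<infinity>\<close>, for which the first integral is finite.\<close>

definition circle_mean :: "(complex \<Rightarrow> ereal) \<Rightarrow> complex \<Rightarrow> real \<Rightarrow> ereal" where
  "circle_mean u w r =
     (enn2ereal (\<integral>\<^sup>+t\<in>{0..2*pi}. e2ennreal (u (w + of_real r * cis t)) \<partial>lborel)
      - enn2ereal (\<integral>\<^sup>+t\<in>{0..2*pi}. e2ennreal (- u (w + of_real r * cis t)) \<partial>lborel))
     / ereal (2 * pi)"

text \<open>Subharmonic functions with values in \<open>[-\<infinity>, \<infinity>)\<close>: upper semicontinuity and the local
  submean inequality. The constant \<open>-\<infinity>\<close> is allowed.\<close>

definition subharmonic_on :: "(complex \<Rightarrow> ereal) \<Rightarrow> complex set \<Rightarrow> bool" where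
  "subharmonic_on u \<Omega> \<longleftrightarrow>
     (\<forall>z\<in>\<Omega>. u z < \<infinity>) \<and>
     (\<forall>c. openin (top_of_set \<Omega>) {z \<in> \<Omega>. u z < c}) \<and>
     (\<forall>w\<in>\<Omega>. \<exists>\<rho>>0. ball w \<rho> \<subseteq> \<Omega> \<and> (\<forall>r. 0 < r \<and> r < \<rho> \<longrightarrow> u w \<le> circle_mean u w r))"

text \<open>The Perron solution of the generalized Dirichlet problem in \<open>\<Omega>\<close> with boundary data \<open>f\<close>.
  The class consists of functions that are bounded above, so that the point at infinity can be
  disregarded as a boundary point of an unbounded \<open>\<Omega>\<close>; for bounded \<open>\<Omega>\<close> and bounded \<open>f\<close> this
  follows from the boundary condition.\<close>

definition perron_class :: "complex set \<Rightarrow> (complex \<Rightarrow> real) \<Rightarrow> (complex \<Rightarrow> ereal) set" where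
  "perron_class \<Omega> f =
     {u. subharmonic_on u \<Omega> \<and> (\<exists>M::real. \<forall>z\<in>\<Omega>. u z \<le> ereal M) \<and>
         (\<forall>\<zeta>\<in>frontier \<Omega>. Limsup (at \<zeta> within \<Omega>) u \<le> ereal (f \<zeta>))}"

definition perron_solution :: "complex set \<Rightarrow> (complex \<Rightarrow> real) \<Rightarrow> complex \<Rightarrow> ereal" where
  "perron_solution \<Omega> f z = (SUP u\<in>perron_class \<Omega> f. u z)"

text \<open>Harmonic measure at \<open>z \<in> D - E\<close> of a Borel set \<open>E\<close> in the closure of \<open>D\<close>, with respect to
  the component of \<open>D - E\<close> containing \<open>z\<close>.\<close>

definition harmonic_measure :: "complex set \<Rightarrow> complex \<Rightarrow> complex set \<Rightarrow> ereal" where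
  "harmonic_measure D z E =
     perron_solution (connected_component_set (D - E) z) (indicator E) z"

end

(*
  Let r be the distance from 0 to F_\<alpha>, so that exp (- d(0, F_\<alpha>)) is comparable to 1 - r.

  Lower bound for the harmonic measure, of order 1 - r. Let c be a point of F_\<alpha> with |c| = r and let s
  be a branch of the square root of the Blaschke factor with zero c, on the component of D - F_\<alpha>
  containing 0. The image A of s is disjoint from -A. Hence on a circle |w| = t < 1 the
  complement of A has measure at least half of the circle. The Poisson integral of that complement,
  composed with s and extended by 0 to |s| \<ge> t, is subharmonic and vanishes near the unit circle, so it
  is a competitor in the Perron class. At 0 it is at least of order 1 - |s 0| = 1 - sqrt r by
  Harnack's inequality.

  Upper bound, of order N(2\<alpha>) (1 - r) for the level 2\<alpha>. On the disc of radius r the modulus of \<psi> is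
  at most \<alpha>, so a component C of F_(2\<alpha>) lies within 1 - r of the unit circle, and along every
  horizontal segment of length O(1 - r) ending on C (after a rotation) \<psi> varies by at least \<alpha>. The
  length-area method, with the area of \<psi>({|\<psi>| < 2\<alpha>}) being O(\<alpha>^2), shows that the diameter
  of C is O(1 - r). Hence a multiple of a Poisson kernel with pole just outside the disc
  majorizes 1 on C and has size O(1 - r) at 0. The sum over all C is a majorant of the Perron class.

  On the scale of ln \<alpha> the two bounds agree.
*)
theory Submission
  imports Defs "HOL-Complex_Analysis.Complex_Analysis" "HOL-Real_Asymp.Real_Asymp"
begin

section \<open>Length and area\<close>

lemma Basis_vec2: "Basis = {axis 1 1, axis 2 (1::real) :: real^2}"
  by (auto simp: Basis_vec_def UNIV_2)

lemma measurable_vector2: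
  "(\<lambda>(x, y). vector [x, y] :: real^2) \<in> (lborel \<Otimes>\<^sub>M lborel) \<rightarrow>\<^sub>M borel"
  by (subst borel_measurable_euclidean_space) (auto simp: Basis_vec2 inner_axis split_beta)

text \<open>Change of variables takes place in \<open>real^2\<close>, while the length-area method
  integrates slice by slice. The identity with a product measure makes Tonelli's theorem available
  for the area integral.\<close>

lemma lborel_vec2:
  "(lborel :: (real^2) measure) = distr (lborel \<Otimes>\<^sub>M lborel) borel (\<lambda>(x, y). vector [x, y])"
proof (rule lborel_eqI)
  fix l u :: "real^2" assume le: "\<And>b. b \<in> Basis \<Longrightarrow> l \<bullet> b \<le> u \<bullet> b"
  have ne: "axis 1 1 \<noteq> (axis 2 1 :: real^2)" by (simp add: axis_eq_axis)
  have "(\<lambda>(x, y). vector [x, y] :: real^2) -` box l u \<inter> space (lborel \<Otimes>\<^sub>M lborel) =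
     {l$1<..<u$1} \<times> {l$2<..<u$2}"
    by (auto simp: space_pair_measure box_def Basis_vec2 inner_axis)
  moreover have "l $ 1 \<le> u $ 1" "l $ 2 \<le> u $ 2"
    using le[of "axis 1 1"] le[of "axis 2 1"] by (auto simp: Basis_vec2 inner_axis)
  ultimately show "emeasure (distr (lborel \<Otimes>\<^sub>M lborel) borel (\<lambda>(x, y). vector [x, y])) (box l u) =
     ennreal (\<Prod>b\<in>Basis. (u - l) \<bullet> b)"
    using ne by (subst emeasure_distr[OF measurable_vector2])
     (auto simp: lborel.emeasure_pair_measure_Times Basis_vec2 inner_axis ennreal_mult)
qed simp

text \<open>The integrand is the Jacobian of \<open>f\<close> as a real map, so by injectivity the
  integral is the area of the image of \<open>U\<close>. The constant is the area of the square of
  side 2a around the disc of radius \<open>a\<close>. The inner integral runs along horizontal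
  lines, as needed for the slices below.\<close>

lemma nn_integral_deriv_le_area:
  assumes U: "open U" and f: "f holomorphic_on U" and inj: "inj_on f U" and sub: "f ` U \<subseteq> ball 0 a" and a: "a > 0"
  shows "(\<integral>\<^sup>+y. \<integral>\<^sup>+x. ennreal ((cmod (deriv f (Complex x y)))\<^sup>2) * indicator U (Complex x y) \<partial>lborel \<partial>lborel)
      \<le> ennreal (4 * a\<^sup>2)"
proof -
  define \<phi> :: "real^2 \<Rightarrow> complex" where "\<phi> = (\<lambda>v. Complex (v$1) (v$2))"
  define \<phi>i :: "complex \<Rightarrow> real^2" where "\<phi>i = (\<lambda>z. vector [Re z, Im z])"
  have inv: "\<phi> (\<phi>i z) = z" "\<phi>i (\<phi> v) = v" for z v
    by (auto simp: \<phi>_def \<phi>i_def vec_eq_iff forall_2 complex_eq_iff)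
  have lin: "linear \<phi>" "linear \<phi>i"
    by (auto simp: \<phi>_def \<phi>i_def linear_iff vec_eq_iff forall_2 complex_eq_iff)
  then have bl: "bounded_linear \<phi>" "bounded_linear \<phi>i"
    by (simp_all add: linear_conv_bounded_linear)
  define S where "S = \<phi> -` U"
  define g where "g = (\<lambda>v. \<phi>i (f (\<phi> v)))"
  define g' where "g' = (\<lambda>v h. \<phi>i (deriv f (\<phi> v) * \<phi> h))"
  have oS: "open S"
    unfolding S_def by (rule open_vimage[OF U]) (intro linear_continuous_on bl)
  have der: "(g has_derivative g' v) (at v within S)" if "v \<in> S" for v
  proof -
    have "(f has_field_derivative deriv f (\<phi> v)) (at (\<phi> v))"
      using f U that by (simp add: S_def holomorphic_derivI)
    then have "(f has_derivative (*) (deriv f (\<phi> v))) (at (\<phi> v))"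
      by (simp add: has_field_derivative_def)
    from has_derivative_compose[OF bounded_linear.has_derivative[OF bl(1) has_derivative_ident] this]
    have "((\<lambda>v. f (\<phi> v)) has_derivative (\<lambda>h. deriv f (\<phi> v) * \<phi> h)) (at v)" by simp
    from bounded_linear.has_derivative[OF bl(2) this] show ?thesis
      unfolding g_def g'_def by (rule has_derivative_at_withinI)
  qed
  \<comment> \<open>The real derivative of \<open>f\<close> is multiplication by a complex number,
    and the determinant of this map is the squared modulus of that number.\<close>
  have det: "\<bar>det (matrix (g' v))\<bar> = (cmod (deriv f (\<phi> v)))\<^sup>2" for v
    by (simp add: det_2 matrix_def g'_def \<phi>i_def \<phi>_def axis_def cmod_power2 flip: power2_eq_square)
  have injg: "inj_on g S"
    using inj by (auto simp: inj_on_def g_def S_def) (metis inv)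
  have gS: "g ` S = \<phi> -` (f ` U)"
  proof (intro set_eqI iffI)
    fix v assume "v \<in> \<phi> -` (f ` U)"
    then obtain u where u: "u \<in> U" "\<phi> v = f u" by auto
    then have "v = g (\<phi>i u)" "\<phi>i u \<in> S" by (simp_all add: g_def S_def inv flip: u(2))
    then show "v \<in> g ` S" by blast
  qed (auto simp: g_def S_def inv)
  have "open (f ` U)"
    by (rule open_mapping_thm3[OF f U inj])
  then have og: "open (g ` S)" unfolding gS
    by (rule open_vimage) (intro linear_continuous_on bl)
  have sub': "g ` S \<subseteq> cbox (vector [-a,-a]) (vector [a,a])"
  proof
    fix v assume "v \<in> g ` S"
    then have "cmod (\<phi> v) < a" using sub by (auto simp: gS)
    then have "\<bar>v$1\<bar> < a" "\<bar>v$2\<bar> < a"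
      using abs_Re_le_cmod[of "\<phi> v"] abs_Im_le_cmod[of "\<phi> v"] by (auto simp: \<phi>_def)
    then show "v \<in> cbox (vector [-a,-a]) (vector [a,a])"
      by (auto simp: mem_box_cart forall_2)
  qed
  have lm: "g ` S \<in> lmeasurable"
    using og sub' bounded_subset[OF bounded_cbox sub'] by (simp add: lmeasurable_open)
  have ne: "axis 1 1 \<noteq> (axis 2 1 :: real^2)" by (simp add: axis_eq_axis)
  have le: "measure lebesgue (g ` S) \<le> 4 * a\<^sup>2"
  proof -
    have "measure lebesgue (g ` S) \<le> measure lebesgue (cbox (vector [-a,-a]) (vector [a,a] :: real^2))"
      using sub' lm by (intro measure_mono_fmeasurable) auto
    also have "\<dots> = measure lborel (cbox (vector [-a,-a]) (vector [a,a] :: real^2))"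
      by (rule measure_completion) simp
    also have "\<dots> = 4 * a\<^sup>2" using a ne
      by (subst content_cbox) (auto simp: Basis_vec2 inner_axis power2_eq_square)
    finally show ?thesis .
  qed
  have S: "S \<in> sets lebesgue" using oS by simp
  have int: "(\<lambda>x. \<bar>det (matrix (g' x))\<bar>) integrable_on S"
    using measurable_differentiable_image_eq[OF S der injg] lm by simp
  have "integral S (\<lambda>x. \<bar>det (matrix (g' x))\<bar>) \<le> 4 * a\<^sup>2"
    using measure_differentiable_image_eq[OF S der injg int] le by simp
  moreover have "(\<integral>\<^sup>+v. ennreal ((cmod (deriv f (\<phi> v)))\<^sup>2) * indicator S v \<partial>lborel) =
     ennreal (integral S (\<lambda>x. \<bar>det (matrix (g' x))\<bar>))"
    using nn_integral_has_integral_lebesgue'[OF _ integrable_integral[OF int]] by (simp add: det)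
  moreover have "(\<integral>\<^sup>+v. ennreal ((cmod (deriv f (\<phi> v)))\<^sup>2) * indicator S v \<partial>lborel) =
    (\<integral>\<^sup>+y. \<integral>\<^sup>+x. ennreal ((cmod (deriv f (Complex x y)))\<^sup>2) * indicator U (Complex x y) \<partial>lborel \<partial>lborel)"
  proof -
    have c1: "continuous_on S (\<lambda>v. (cmod (deriv f (\<phi> v)))\<^sup>2)"
      unfolding S_def
      by (intro continuous_intros continuous_on_compose2[OF holomorphic_on_imp_continuous_on[OF holomorphic_deriv[OF f U]]] linear_continuous_on bl) auto
    have m: "(\<lambda>v. ennreal ((cmod (deriv f (\<phi> v)))\<^sup>2) * indicator S v) \<in> borel_measurable borel"
    proof -
      have "(\<lambda>v. ennreal (indicator S v *\<^sub>R (cmod (deriv f (\<phi> v)))\<^sup>2)) \<in> borel_measurable borel"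
        using borel_measurable_continuous_on_indicator[OF _ c1] oS by simp
      then show ?thesis
        by (rule measurable_cong[THEN iffD1, rotated]) (auto simp: indicator_def)
    qed
    have m': "(\<lambda>v. ennreal ((cmod (deriv f (\<phi> v)))\<^sup>2) * indicator S v) \<circ> (\<lambda>(x, y). vector [x, y]) \<in> borel_measurable (lborel \<Otimes>\<^sub>M lborel)"
      by (rule measurable_comp[OF measurable_vector2 m])
    have "(\<integral>\<^sup>+v. ennreal ((cmod (deriv f (\<phi> v)))\<^sup>2) * indicator S v \<partial>lborel) =
      (\<integral>\<^sup>+p. ((\<lambda>v. ennreal ((cmod (deriv f (\<phi> v)))\<^sup>2) * indicator S v) \<circ> (\<lambda>(x, y). vector [x, y])) p \<partial>(lborel \<Otimes>\<^sub>M lborel))"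
      unfolding lborel_vec2 using measurable_vector2 m by (subst nn_integral_distr) (auto simp: comp_def)
    also have "\<dots> = (\<integral>\<^sup>+y. \<integral>\<^sup>+x. ((\<lambda>v. ennreal ((cmod (deriv f (\<phi> v)))\<^sup>2) * indicator S v) \<circ> (\<lambda>(x, y). vector [x, y])) (x, y) \<partial>lborel \<partial>lborel)"
      by (rule lborel_pair.nn_integral_snd[symmetric]) (use m' in \<open>simp add: split_beta comp_def\<close>)
    finally show ?thesis by (simp add: \<phi>_def S_def indicator_def)
  qed
  ultimately show ?thesis by (metis ennreal_leI)
qed

section \<open>Length-area estimates for the components of a level set\<close>

lemma first_hit:
  fixes s :: "real \<Rightarrow> real"
  assumes c: "continuous_on {0..1} s" and "s 0 < a" "s 1 = a"
  obtains \<tau> where "0 < \<tau>" "\<tau> \<le> 1" "s \<tau> = a" "\<And>t. 0 \<le> t \<Longrightarrow> t < \<tau> \<Longrightarrow> s t < a"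
proof -
  define T where "T = {t \<in> {0..1}. s t = a}"
  have "closed T" unfolding T_def
    by (rule continuous_closed_preimage_constant[OF c closed_atLeastAtMost])
  moreover have "1 \<in> T" using assms by (simp add: T_def)
  moreover have "bdd_below T" by (auto simp: T_def intro!: bdd_belowI[of _ 0])
  ultimately have I: "Inf T \<in> T" using closed_contains_Inf[of T] by blast
  have low: "Inf T \<le> t" if "t \<in> T" for t using \<open>bdd_below T\<close> that by (simp add: cInf_lower)
  have "s t < a" if t: "0 \<le> t" "t < Inf T" for t
  proof (rule ccontr)
    assume "\<not> s t < a"
    moreover have "Inf T \<le> 1" using I by (simp add: T_def)
    moreover have "continuous_on {0..t} s" using c that \<open>Inf T \<le> 1\<close> by (auto intro: continuous_on_subset)
    ultimately obtain t' where t': "0 \<le> t'" "t' \<le> t" "s t' = a"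
      using IVT'[of s 0 a t] t \<open>s 0 < a\<close> by (auto simp: not_less)
    then have "t' \<in> T" using that \<open>Inf T \<le> 1\<close> by (simp add: T_def)
    then show False using low[of t'] t'(2) that(2) by linarith
  qed
  moreover have "Inf T \<noteq> 0" using I assms by (auto simp: T_def)
  moreover have "0 \<le> Inf T" "Inf T \<le> 1" "s (Inf T) = a" using I by (auto simp: T_def)
  ultimately show thesis using that[of "Inf T"] by auto
qed

text \<open>Along the segment the modulus of \<open>f\<close> rises from at most a/2 to
  \<open>a\<close>, so \<open>f\<close> changes by at least a/2 over a length of at most 2 \<delta>.
  By Cauchy-Schwarz the energy is at least (a/2)^2 / (2 \<delta>).\<close>

lemma slice_energy_ge:
  assumes f: "f holomorphic_on ball 0 1" and "a > 0" "\<delta> > 0"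
    and p: "Complex p y \<in> ball 0 1" and q: "Complex q y \<in> ball 0 1" and len: "\<bar>q - p\<bar> \<le> 2 * \<delta>"
    and fp: "cmod (f (Complex p y)) \<le> a / 2" and fq: "cmod (f (Complex q y)) = a"
  shows "ennreal (a\<^sup>2 / (8 * \<delta>)) \<le> (\<integral>\<^sup>+x. ennreal ((cmod (deriv f (Complex x y)))\<^sup>2) *
      indicator {z \<in> ball 0 1. cmod (f z) < a} (Complex x y) \<partial>lborel)"
proof -
  have seg: "Complex (p + t * (q - p)) y \<in> ball 0 1" if "0 \<le> t" "t \<le> 1" for t
  proof -
    have "Complex (p + t * (q - p)) y = (1 - t) *\<^sub>R Complex p y + t *\<^sub>R Complex q y"
      by (simp add: complex_eq_iff algebra_simps)
    then show ?thesis using convexD_alt[OF convex_ball p q that] by simp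
  qed
  have Ceq: "Complex x y = of_real x + \<i> * of_real y" for x by (simp add: complex_eq_iff)
  have cont: "continuous_on {0..1} (\<lambda>t. cmod (f (Complex (p + t * (q - p)) y)))"
    by (intro continuous_on_norm continuous_on_compose2[OF holomorphic_on_imp_continuous_on[OF f]])
      (use seg in \<open>auto simp: Ceq intro!: continuous_intros simp del: of_real_add of_real_mult of_real_diff\<close>)
  \<comment> \<open>Stopping at the first point where the modulus equals \<open>a\<close> keeps the
    segment, apart from that point, inside the sublevel set whose energy is counted.\<close>
  obtain \<tau> where \<tau>: "0 < \<tau>" "\<tau> \<le> 1" "cmod (f (Complex (p + \<tau> * (q - p)) y)) = a"
    "\<And>t. 0 \<le> t \<Longrightarrow> t < \<tau> \<Longrightarrow> cmod (f (Complex (p + t * (q - p)) y)) < a"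
    using first_hit[OF cont, of a] fp fq \<open>a > 0\<close> by auto
  define q' where "q' = p + \<tau> * (q - p)"
  define l h where "l = min p q'" and "h = max p q'"
  have "p \<noteq> q" using fp fq \<open>a > 0\<close> by auto
  have lh: "(p < q \<and> l = p \<and> h = q') \<or> (q < p \<and> l = q' \<and> h = p)"
  proof (cases "p < q")
    case True
    then have "0 \<le> \<tau> * (q - p)" using \<tau>(1) by simp
    then show ?thesis using True by (simp add: l_def h_def q'_def)
  next
    case False
    then have "q < p" using \<open>p \<noteq> q\<close> by simp
    moreover have "\<tau> * (q - p) \<le> 0" using \<tau>(1) \<open>q < p\<close> by (intro mult_nonneg_nonpos) auto
    ultimately show ?thesis by (simp add: l_def h_def q'_def)
  qed
  have par: "\<exists>t. 0 \<le> t \<and> t \<le> \<tau> \<and> x = p + t * (q - p)" if "l \<le> x" "x \<le> h" for x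
  proof (intro exI conjI)
    show "x = p + ((x - p) / (q - p)) * (q - p)" using \<open>p \<noteq> q\<close> by simp
    show "0 \<le> (x - p) / (q - p)" using lh that by (auto simp: zero_le_divide_iff)
    show "(x - p) / (q - p) \<le> \<tau>"
      using lh that by (auto simp: q'_def pos_divide_le_eq neg_divide_le_eq)
  qed
  have inB: "Complex x y \<in> ball 0 1" if "l \<le> x" "x \<le> h" for x
    using par[OF that] seg \<tau>(2) by (metis order_trans)
  have inU: "cmod (f (Complex x y)) < a" if "l \<le> x" "x \<le> h" "x \<noteq> q'" for x
    using par[OF that(1,2)] \<tau>(4) that(3) q'_def by (metis order_le_less)
  have "l \<le> h" by (simp add: l_def h_def)
  have hl: "h - l \<le> 2 * \<delta>"
  proof -
    have "h - l = \<tau> * \<bar>q - p\<bar>" using lh by (auto simp: q'_def algebra_simps)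
    also have "\<dots> \<le> 1 * \<bar>q - p\<bar>" using \<tau>(2) by (intro mult_right_mono) auto
    finally show ?thesis using len by simp
  qed
  define g where "g = (\<lambda>x. cmod (deriv f (Complex x y)))"
  have "continuous_on {l..h} g"
    unfolding g_def by (intro continuous_on_norm continuous_on_compose2[OF holomorphic_on_imp_continuous_on[OF holomorphic_deriv[OF f open_ball]]])
      (use inB in \<open>auto simp: Ceq intro!: continuous_intros\<close>)
  then have gint: "(\<lambda>x. (g x)\<^sup>2) integrable_on {l..h}"
    by (intro integrable_continuous_interval continuous_intros)
  define J where "J = integral {l..h} (\<lambda>x. (g x)\<^sup>2)"
  have ft: "((\<lambda>x. deriv f (Complex x y)) has_integral (f (Complex h y) - f (Complex l y))) {l..h}"
  proof (rule fundamental_theorem_of_calculus[OF \<open>l \<le> h\<close>])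
    fix x assume x: "x \<in> {l..h}"
    then have "(f has_field_derivative deriv f (Complex x y)) (at (Complex x y))"
      using f inB by (intro holomorphic_derivI[OF f]) auto
    moreover have "((\<lambda>x. Complex x y) has_vector_derivative 1) (at x within {l..h})"
      unfolding Ceq by (auto intro!: derivative_eq_intros)
    ultimately have "((f \<circ> (\<lambda>x. Complex x y)) has_vector_derivative (1 * deriv f (Complex x y))) (at x within {l..h})"
      by (intro field_vector_diff_chain_within) (auto intro: has_field_derivative_at_within)
    then show "((\<lambda>x. f (Complex x y)) has_vector_derivative deriv f (Complex x y)) (at x within {l..h})"
      by (simp add: comp_def)
  qed
  \<comment> \<open>Cauchy-Schwarz is used in the form g <= (g^2/c + c)/2. The optimal constant is
    the mean slope (a/2) / (2 \<delta>).\<close>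
  define c where "c = a / (4 * \<delta>)"
  have "c > 0" using assms by (simp add: c_def)
  have amgm: "g x \<le> ((g x)\<^sup>2 / c + c) / 2" for x
  proof -
    have "0 \<le> (g x - c)\<^sup>2 / (2 * c)" using \<open>c > 0\<close> by simp
    also have "\<dots> = ((g x)\<^sup>2 / c + c) / 2 - g x" using \<open>c > 0\<close> by (simp add: field_simps power2_eq_square)
    finally show ?thesis by simp
  qed
  have "a / 2 \<le> cmod (f (Complex h y) - f (Complex l y))"
  proof -
    have "a / 2 \<le> cmod (f (Complex q' y)) - cmod (f (Complex p y))" using fp \<tau>(3) by (simp add: q'_def)
    also have "\<dots> \<le> cmod (f (Complex q' y) - f (Complex p y))" by (rule norm_triangle_ineq2)
    also have "\<dots> = cmod (f (Complex h y) - f (Complex l y))" by (auto simp: l_def h_def min_def max_def norm_minus_commute)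
    finally show ?thesis .
  qed
  also have "\<dots> \<le> J / (2 * c) + c * (h - l) / 2"
  proof -
    have hi: "((\<lambda>x. ((g x)\<^sup>2 / c + c) / 2) has_integral ((J / c + (h - l) *\<^sub>R c) / 2)) {l..h}"
      using has_integral_const_real[of c l h] \<open>l \<le> h\<close> unfolding J_def
      by (intro has_integral_divide has_integral_add integrable_integral gint) auto
    have "cmod (f (Complex h y) - f (Complex l y)) \<le> integral {l..h} (\<lambda>x. ((g x)\<^sup>2 / c + c) / 2)"
      unfolding integral_unique[OF ft, symmetric]
      by (rule integral_norm_bound_integral[OF has_integral_integrable[OF ft] has_integral_integrable[OF hi]])
        (use amgm in \<open>simp add: g_def\<close>)
    also have "\<dots> = (J / c + (h - l) *\<^sub>R c) / 2" by (rule integral_unique[OF hi])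
    also have "\<dots> = J / (2 * c) + c * (h - l) / 2" by (simp add: field_simps)
    finally show ?thesis .
  qed
  also have "c * (h - l) / 2 \<le> c * (2 * \<delta>) / 2" using hl \<open>c > 0\<close> by (intro divide_right_mono mult_left_mono) auto
  also have "J / (2 * c) + c * (2 * \<delta>) / 2 = 2 * \<delta> * J / a + a / 4"
    using assms by (simp add: c_def field_simps)
  finally have "a / 4 \<le> 2 * \<delta> * J / a" by simp
  then have "a\<^sup>2 / (8 * \<delta>) \<le> J" using assms by (simp add: field_simps power2_eq_square)
  then have "ennreal (a\<^sup>2 / (8 * \<delta>)) \<le> ennreal J" by (rule ennreal_leI)
  also have "ennreal J = (\<integral>\<^sup>+x. ennreal ((g x)\<^sup>2) * indicator {l..h} x \<partial>lborel)"
    unfolding J_def by (rule nn_integral_has_integral_lebesgue'[symmetric, OF _ integrable_integral[OF gint]]) simp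
  also have "\<dots> \<le> (\<integral>\<^sup>+x. ennreal ((cmod (deriv f (Complex x y)))\<^sup>2) *
      indicator {z \<in> ball 0 1. cmod (f z) < a} (Complex x y) \<partial>lborel)"
  proof (rule nn_integral_mono_AE)
    \<comment> \<open>The end point \<open>q'\<close> lies on the level set and hence outside the
      sublevel set, but a single point is a null set.\<close>
    show "AE x in lborel. ennreal ((g x)\<^sup>2) * indicator {l..h} x \<le> ennreal ((cmod (deriv f (Complex x y)))\<^sup>2) *
                indicator {z \<in> ball 0 1. cmod (f z) < a} (Complex x y)"
      using AE_lborel_singleton[of q']
    proof eventually_elim
      case (elim x)
      then show ?case using inB[of x] inU[of x] by (auto simp: g_def indicator_def)
    qed
  qed
  finally show ?thesis .
qed

text \<open>The connected set \<open>C\<close> contains a point on the real axis, so the heights of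
  its points fill the interval between 0 and \<open>Im z\<close>. If Y is the length of a part of it
  on which \<open>slice_energy_ge\<close> applies, the total energy is at least a^2 Y / (8
  \<delta>). The area allows at most 4 a^2, whence Y <= 32 \<delta>.\<close>

lemma level_arc_Im_le:
  assumes f: "f holomorphic_on ball 0 1" and inj: "inj_on f (ball 0 1)" and "a > 0" and \<delta>: "0 < \<delta>" "\<delta> < 1/64"
    and small: "\<And>z. cmod z \<le> 1 - \<delta> \<Longrightarrow> cmod (f z) \<le> a / 2"
    and C: "connected C" "C \<subseteq> ball 0 1" "\<And>z. z \<in> C \<Longrightarrow> cmod (f z) = a"
    and c0: "c0 \<in> C" "Im c0 = 0" and z: "z \<in> C"
  shows "\<bar>Im z\<bar> \<le> 32 * \<delta>"
proof -
  define U where "U = {z \<in> ball 0 1. cmod (f z) < a}"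
  define G where "G = (\<lambda>y. \<integral>\<^sup>+x. ennreal ((cmod (deriv f (Complex x y)))\<^sup>2) * indicator U (Complex x y) \<partial>lborel)"
  have oU: "open U" unfolding U_def
    using continuous_open_preimage[OF continuous_on_norm[OF holomorphic_on_imp_continuous_on[OF f]] open_ball open_lessThan[of a]]
    by (simp add: vimage_def Int_def)
  have G: "(\<integral>\<^sup>+y. G y \<partial>lborel) \<le> ennreal (4 * a\<^sup>2)"
    unfolding G_def
    by (rule nn_integral_deriv_le_area[OF oU _ _ _ \<open>a > 0\<close>])
       (auto simp: U_def intro: holomorphic_on_subset[OF f] inj_on_subset[OF inj])
  have slice: "ennreal (a\<^sup>2 / (8 * \<delta>)) \<le> G y" if y: "y \<in> Im ` C" "\<bar>y\<bar> \<le> 1/2" for y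
  proof -
    from y obtain x where x: "Complex x y \<in> C" by (metis complex_surj image_iff)
    \<comment> \<open>\<open>b\<close> is half the chord of the circle of radius 1 - \<delta> at
      height \<open>y\<close>, and \<open>Complex p y\<close> is its end on the side of
      \<open>x\<close>. As |y| <= 1/2, also b >= 1/2, so the circle is not met tangentially and the
      horizontal gap |x| - b is O(\<delta>): because |x| + b >= 1, it is at most the difference of
      the squares.\<close>
    define b where "b = sqrt ((1-\<delta>)\<^sup>2 - y\<^sup>2)"
    define p where "p = sgn x * b"
    have "(63/64)\<^sup>2 \<le> (1-\<delta>)\<^sup>2" using \<delta> by (intro power_mono) auto
    moreover have y2: "y\<^sup>2 \<le> (1/2)\<^sup>2" using y(2) by (simp add: abs_le_square_iff[symmetric])
    ultimately have b2: "b\<^sup>2 = (1-\<delta>)\<^sup>2 - y\<^sup>2" and "b\<^sup>2 \<ge> (1/2)\<^sup>2" unfolding b_def by (auto simp: power2_eq_square)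
    moreover have "b \<ge> 0" using \<open>(63/64)\<^sup>2 \<le> (1-\<delta>)\<^sup>2\<close> y2 by (simp add: b_def power2_eq_square)
    ultimately have b: "b \<ge> 1/2" by (metis power2_le_imp_le)
    have nx: "cmod (Complex x y) < 1" "cmod (f (Complex x y)) = a" using x C by auto
    then have "\<not> cmod (Complex x y) \<le> 1 - \<delta>" using small \<open>a > 0\<close> by fastforce
    then have "(1-\<delta>)\<^sup>2 < (cmod (Complex x y))\<^sup>2" using \<delta> by (intro power_strict_mono) auto
    then have "(1-\<delta>)\<^sup>2 < x\<^sup>2 + y\<^sup>2" by (simp add: cmod_power2)
    then have "b\<^sup>2 < \<bar>x\<bar>\<^sup>2" using b2 by simp
    then have bx: "b < \<bar>x\<bar>" using power_less_imp_less_base abs_ge_zero by blast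
    then have "x \<noteq> 0" using b by auto
    have np: "cmod (Complex p y) = 1 - \<delta>"
      using \<open>x \<noteq> 0\<close> \<delta> by (simp add: complex_norm p_def power_mult_distrib b2 sgn_if)
    have "\<bar>x - p\<bar> = \<bar>x\<bar> - b" using bx b by (auto simp: p_def sgn_if abs_if)
    also have "\<dots> \<le> 2 * \<delta>"
    proof -
      have "(\<bar>x\<bar> - b) * 1 \<le> (\<bar>x\<bar> - b) * (\<bar>x\<bar> + b)" using b bx by (intro mult_left_mono) auto
      also have "\<dots> = x\<^sup>2 + y\<^sup>2 - (1-\<delta>)\<^sup>2" by (simp add: square_diff_square_factored algebra_simps b2 flip: power2_eq_square)
      also have "\<dots> \<le> 1 - (1-\<delta>)\<^sup>2" using nx(1) by (simp add: complex_norm)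
      also have "\<dots> \<le> 2 * \<delta>" by (simp add: power2_eq_square algebra_simps)
      finally show ?thesis by simp
    qed
    finally have "\<bar>x - p\<bar> \<le> 2 * \<delta>" .
    then show ?thesis unfolding G_def U_def
      using nx small[of "Complex p y"] np \<delta> by (intro slice_energy_ge[OF f \<open>a > 0\<close> \<delta>(1), of p y x]) auto
  qed
  show ?thesis
  proof (rule ccontr)
    assume neg: "\<not> ?thesis"
    \<comment> \<open>The cap at 1/2 keeps the heights in the range of \<open>slice\<close>. Since
      32 \<delta> < 1/2, the capped length still exceeds 32 \<delta>.\<close>
    define Y where "Y = min \<bar>Im z\<bar> (1/2)"
    have Y: "Y > 32 * \<delta>" "Y \<le> 1/2" "Y \<le> \<bar>Im z\<bar>" using neg \<delta> by (auto simp: Y_def)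
    define l where "l = (if Im z \<ge> 0 then 0 else -Y)"
    have conn: "connected (Im ` C)" using C(1) by (intro connected_continuous_image continuous_intros)
    have sub: "{l..l+Y} \<subseteq> Im ` C"
    proof (cases "Im z \<ge> 0")
      case True
      then have "{0..Im z} \<subseteq> Im ` C" using connected_contains_Icc[OF conn, of 0 "Im z"] c0 z by force
      then show ?thesis using True Y by (auto simp: l_def)
    next
      case False
      then have "{Im z..0} \<subseteq> Im ` C" using connected_contains_Icc[OF conn, of "Im z" 0] c0 z by force
      then show ?thesis using False Y by (auto simp: l_def)
    qed
    have "ennreal (a\<^sup>2 / (8 * \<delta>) * Y) = (\<integral>\<^sup>+y. ennreal (a\<^sup>2 / (8 * \<delta>)) * indicator {l..l+Y} y \<partial>lborel)"
    proof -
      have "ennreal (a\<^sup>2 / (8 * \<delta>) * Y) = ennreal (a\<^sup>2 / (8 * \<delta>)) * ennreal Y"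
        by (rule ennreal_mult) (use Y \<delta> in auto)
      then show ?thesis using Y \<delta> by (subst nn_integral_cmult_indicator) auto
    qed
    also have "\<dots> \<le> (\<integral>\<^sup>+y. G y \<partial>lborel)"
    proof (rule nn_integral_mono)
      fix y
      show "ennreal (a\<^sup>2 / (8 * \<delta>)) * indicator {l..l+Y} y \<le> G y"
      proof (cases "y \<in> {l..l+Y}")
        case True
        moreover have "\<bar>y\<bar> \<le> 1/2" using True Y by (auto simp: l_def split: if_splits)
        ultimately show ?thesis using slice[of y] sub by (simp add: subset_iff)
      qed simp
    qed
    also note G
    finally have "a\<^sup>2 / (8 * \<delta>) * Y \<le> 4 * a\<^sup>2" by (subst (asm) ennreal_le_iff) auto
    then have "Y \<le> 32 * \<delta>" using \<open>a > 0\<close> \<delta> by (simp add: field_simps)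
    then show False using Y by simp
  qed
qed

text \<open>A rotation moves a chosen point of \<open>C\<close> to the positive real axis, where
  \<open>level_arc_Im_le\<close> bounds all imaginary parts. Since the points of \<open>C\<close>
  have modulus above 1 - \<delta>, a small imaginary part leaves only neighbourhoods of 1 and -1,
  and connectedness excludes the latter.\<close>

lemma level_arc_near_boundary_point:
  assumes f: "f holomorphic_on ball 0 1" and inj: "inj_on f (ball 0 1)" and "a > 0" and \<delta>: "0 < \<delta>" "\<delta> < 1/64"
    and small: "\<And>z. cmod z \<le> 1 - \<delta> \<Longrightarrow> cmod (f z) \<le> a / 2"
    and C: "connected C" "C \<subseteq> ball 0 1" "\<And>z. z \<in> C \<Longrightarrow> cmod (f z) = a"
  obtains \<zeta> where "cmod \<zeta> = 1" "\<And>z. z \<in> C \<Longrightarrow> cmod (z - \<zeta>) \<le> 50 * \<delta>"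
proof (cases "C = {}")
  case True
  then show ?thesis using that[of 1] by simp
next
  case False
  then obtain c where c: "c \<in> C" by blast
  have "\<not> cmod c \<le> 1 - \<delta>" using small[of c] C(3)[OF c] \<open>a > 0\<close> by auto
  then have "c \<noteq> 0" using \<delta> by auto
  define \<zeta> where "\<zeta> = c / of_real (cmod c)"
  have \<zeta>: "cmod \<zeta> = 1" using \<open>c \<noteq> 0\<close> by (simp add: \<zeta>_def norm_divide)
  then have "\<zeta> \<noteq> 0" by auto
  define C' where "C' = (\<lambda>z. z / \<zeta>) ` C"
  define f' where "f' = (\<lambda>z. f (\<zeta> * z))"
  have 1: "f' holomorphic_on ball 0 1"
    unfolding f'_def by (rule holomorphic_on_compose_gen[OF _ f, unfolded comp_def])
      (auto simp: norm_mult \<zeta> intro!: holomorphic_intros)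
  have 2: "inj_on f' (ball 0 1)"
  proof (rule inj_onI)
    fix x y assume "x \<in> ball 0 1" "y \<in> ball 0 1" "f' x = f' y"
    then have "\<zeta> * x = \<zeta> * y" using inj_onD[OF inj, of "\<zeta> * x" "\<zeta> * y"] by (simp add: f'_def norm_mult \<zeta>)
    then show "x = y" using \<open>\<zeta> \<noteq> 0\<close> by simp
  qed
  have 3: "cmod (f' z) \<le> a / 2" if "cmod z \<le> 1 - \<delta>" for z
    using small[of "\<zeta> * z"] that by (simp add: f'_def norm_mult \<zeta>)
  have 4: "connected C'"
    unfolding C'_def using C(1) \<open>\<zeta> \<noteq> 0\<close> by (intro connected_continuous_image continuous_intros) auto
  have 5: "C' \<subseteq> ball 0 1" "\<And>z. z \<in> C' \<Longrightarrow> cmod (f' z) = a"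
    using C \<open>\<zeta> \<noteq> 0\<close> by (auto simp: C'_def f'_def norm_divide \<zeta>)
  have ceq: "c / \<zeta> = of_real (cmod c)" using \<open>c \<noteq> 0\<close> by (simp add: \<zeta>_def)
  have 6: "c / \<zeta> \<in> C'" unfolding C'_def using c by (rule imageI)
  have 7: "Im (c / \<zeta>) = 0" by (simp add: ceq)
  have Im: "\<bar>Im w\<bar> \<le> 32 * \<delta>" if "w \<in> C'" for w
    by (rule level_arc_Im_le[OF 1 2 \<open>a > 0\<close> \<delta> 3 4 5 6 7 that])
  have far: "\<not> cmod w \<le> 1 - \<delta>" if "w \<in> C'" for w
    using 3[of w] 5(2)[OF that] \<open>a > 0\<close> by auto
  \<comment> \<open>Otherwise the rotated component would cross the imaginary axis, at a point of
    modulus at most 32 \<delta> < 1/2, where the modulus of \<open>f'\<close> is at most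
    a/2.\<close>
  have Re: "Re w > 0" if "w \<in> C'" for w
  proof (rule ccontr)
    assume "\<not> Re w > 0"
    have "connected (Re ` C')" using 4 by (intro connected_continuous_image continuous_intros)
    then have "{Re w..Re (c / \<zeta>)} \<subseteq> Re ` C'" by (rule connected_contains_Icc) (use 6 that in blast)+
    moreover have "0 \<in> {Re w..Re (c / \<zeta>)}" using \<open>\<not> Re w > 0\<close> by (auto simp: ceq)
    ultimately obtain v where v: "v \<in> C'" "Re v = 0" by (metis imageE subsetD)
    have "cmod v = \<bar>Im v\<bar>" using v(2) by (simp add: cmod_eq_Im)
    then show False using Im[OF v(1)] far[OF v(1)] \<delta> by auto
  qed
  \<comment> \<open>Since \<delta> < 1/64, (32 \<delta>)^2 <= 16 \<delta>. With |w|^2 > 1 - 2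
    \<delta> this gives 1 - Re w <= 1 - (Re w)^2 <= 18 \<delta>, and 18 + 32 = 50.\<close>
  have near: "cmod (w - 1) \<le> 50 * \<delta>" if "w \<in> C'" for w
  proof -
    have w1: "cmod w < 1" using 5(1) that by auto
    have "(1-\<delta>)\<^sup>2 < (cmod w)\<^sup>2" using far[OF that] \<delta> by (intro power_strict_mono) auto
    moreover have "(Im w)\<^sup>2 \<le> (32 * \<delta>)\<^sup>2" using Im[OF that] \<delta> by (metis abs_le_square_iff abs_of_nonneg abs_ge_zero order_trans)
    moreover have "(32 * \<delta>)\<^sup>2 \<le> 16 * \<delta>" using \<delta> by (simp add: power2_eq_square)
    moreover have "(1-\<delta>)\<^sup>2 \<ge> 1 - 2 * \<delta>" by (simp add: power2_eq_square algebra_simps)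
    ultimately have "(Re w)\<^sup>2 \<ge> 1 - 18 * \<delta>" using cmod_power2[of w] by linarith
    moreover have "Re w < 1" using w1 complex_Re_le_cmod[of w] by linarith
    moreover have "Re w * Re w \<le> Re w * 1" using Re[OF that] \<open>Re w < 1\<close> by (intro mult_left_mono) auto
    ultimately have "\<bar>Re w - 1\<bar> \<le> 18 * \<delta>" by (simp add: power2_eq_square)
    then show ?thesis using cmod_le[of "w - 1"] Im[OF that] by simp
  qed
  have "cmod (z - \<zeta>) \<le> 50 * \<delta>" if "z \<in> C" for z
  proof -
    have "cmod (z - \<zeta>) = cmod (z / \<zeta> - 1)"
      using \<open>\<zeta> \<noteq> 0\<close> \<zeta> by (simp add: divide_simps norm_divide flip: norm_divide) (metis div_by_1 norm_divide)
    moreover have "z / \<zeta> \<in> C'" unfolding C'_def using that by (rule imageI)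
    ultimately show ?thesis using near[of "z / \<zeta>"] by simp
  qed
  then show ?thesis using that \<zeta> by blast
qed

section \<open>Circle means and the maximum principle\<close>

text \<open>Cauchy's integral formula at the centre, parametrized by the angle.\<close>

lemma has_integral_circle_mean_holomorphic:
  fixes f :: "complex \<Rightarrow> complex"
  assumes "f holomorphic_on cball w r" "r > 0"
  shows "((\<lambda>t. f (w + of_real r * cis t)) has_integral (2 * pi * f w)) {0..2*pi}"
proof -
  have "((\<lambda>u. f u / (u - w)) has_contour_integral (2 * of_real pi * \<i> * f w)) (part_circlepath w r 0 (2*pi))"
    using Cauchy_integral_circlepath_simple[OF assms(1), of w] assms(2) by (simp add: circlepath_def)
  then have "((\<lambda>t. f (w + of_real r * cis t) / (w + of_real r * cis t - w) * of_real r * \<i> * cis t) has_integral (2 * of_real pi * \<i> * f w)) {0..2*pi}"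
    by (subst (asm) has_contour_integral_part_circlepath_iff) auto
  from has_integral_mult_right[OF this, of "-\<i>"]
  show ?thesis using \<open>r > 0\<close> by (simp add: field_simps)
qed

lemma has_integral_circle_mean_Re:
  assumes "f holomorphic_on cball w r" "r > 0"
  shows "((\<lambda>t. Re (f (w + of_real r * cis t))) has_integral (2 * pi * Re (f w))) {0..2*pi}"
  using has_integral_linear[OF has_integral_circle_mean_holomorphic[OF assms] bounded_linear_Re]
  by (simp add: comp_def)

text \<open>For continuous data the positive and the negative part both have finite integrals, so
  the extended real difference in \<open>circle_mean\<close> is the ordinary integral.\<close>

lemma circle_mean_ereal:
  assumes c: "continuous_on {0..2*pi} (\<lambda>t. g (w + of_real r * cis t))"
    and I: "((\<lambda>t. g (w + of_real r * cis t)) has_integral I) {0..2*pi}"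
  shows "circle_mean (\<lambda>z. ereal (g z)) w r = ereal (I / (2 * pi))"
proof -
  define h where "h = (\<lambda>t. g (w + of_real r * cis t))"
  have e: "e2ennreal (ereal x) = ennreal x" for x
  proof (cases "x \<ge> 0")
    case True
    then show ?thesis by (simp add: e2ennreal_def ennreal_def sup_ereal_def max_def)
  next
    case False
    then show ?thesis by (simp add: e2ennreal_neg ennreal_neg)
  qed
  have ip: "(\<lambda>t. max 0 (h t)) integrable_on {0..2*pi}" "(\<lambda>t. max 0 (- h t)) integrable_on {0..2*pi}"
    using c unfolding h_def by (intro integrable_continuous_interval continuous_intros; simp)+
  have m: "ennreal (max 0 x) = ennreal x" for x by (simp add: max_def ennreal_neg)
  have p: "(\<integral>\<^sup>+t\<in>{0..2*pi}. ennreal (h t) \<partial>lborel) = ennreal (integral {0..2*pi} (\<lambda>t. max 0 (h t)))"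
    "(\<integral>\<^sup>+t\<in>{0..2*pi}. ennreal (- h t) \<partial>lborel) = ennreal (integral {0..2*pi} (\<lambda>t. max 0 (- h t)))"
    using nn_integral_has_integral_lebesgue'[OF _ integrable_integral[OF ip(1)]]
      nn_integral_has_integral_lebesgue'[OF _ integrable_integral[OF ip(2)]] by (simp_all add: m)
  have nn: "0 \<le> integral {0..2*pi} (\<lambda>t. max 0 (h t))" "0 \<le> integral {0..2*pi} (\<lambda>t. max 0 (- h t))"
    by (rule integral_nonneg; simp add: ip)+
  have "I = integral {0..2*pi} (\<lambda>t. max 0 (h t) - max 0 (- h t))"
    using I unfolding h_def[symmetric] by (subst integral_unique[symmetric, OF I, folded h_def]) (auto intro!: integral_cong)
  also have "\<dots> = integral {0..2*pi} (\<lambda>t. max 0 (h t)) - integral {0..2*pi} (\<lambda>t. max 0 (- h t))"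
    by (rule integral_diff[OF ip])
  finally show ?thesis
    unfolding circle_mean_def using p nn by (simp add: e h_def enn2ereal_ennreal)
qed

lemma circle_mean_mono:
  assumes "\<And>t. u (w + of_real r * cis t) \<le> v (w + of_real r * cis t)"
  shows "circle_mean u w r \<le> circle_mean v w r"
  unfolding circle_mean_def
proof (intro ereal_divide_right_mono ereal_minus_mono)
  show "enn2ereal (\<integral>\<^sup>+t\<in>{0..2*pi}. e2ennreal (u (w + of_real r * cis t)) \<partial>lborel)
      \<le> enn2ereal (\<integral>\<^sup>+t\<in>{0..2*pi}. e2ennreal (v (w + of_real r * cis t)) \<partial>lborel)"
    unfolding less_eq_ennreal.rep_eq[symmetric] using assms
    by (intro nn_integral_mono mult_right_mono e2ennreal_mono) auto
  show "enn2ereal (\<integral>\<^sup>+t\<in>{0..2*pi}. e2ennreal (- v (w + of_real r * cis t)) \<partial>lborel)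
      \<le> enn2ereal (\<integral>\<^sup>+t\<in>{0..2*pi}. e2ennreal (- u (w + of_real r * cis t)) \<partial>lborel)"
    unfolding less_eq_ennreal.rep_eq[symmetric] using assms
    by (intro nn_integral_mono mult_right_mono e2ennreal_mono) auto
qed auto

text \<open>Subtracting \<open>\<epsilon> \<bar>z\<bar>\<^sup>2\<close> from the harmonic majorant makes it strictly superharmonic, so that a
  maximum of the difference is contradictory without a connectedness argument.\<close>

lemma subharmonic_le_Re_holomorphic:
  assumes \<Omega>: "open \<Omega>" "bounded \<Omega>" and u: "subharmonic_on u \<Omega>"
    and h: "h holomorphic_on \<Omega>" "continuous_on (closure \<Omega>) h"
    and bd: "\<And>\<zeta>. \<zeta> \<in> frontier \<Omega> \<Longrightarrow> Limsup (at \<zeta> within \<Omega>) u \<le> ereal (Re (h \<zeta>))"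
    and z: "z \<in> \<Omega>"
  shows "u z \<le> ereal (Re (h z))"
proof (rule ccontr)
  assume "\<not> u z \<le> ereal (Re (h z))"
  then obtain q where q: "Re (h z) < q" "ereal q < u z"
    using ereal_dense2[of "ereal (Re (h z))" "u z"] by (auto simp: not_le)
  \<comment> \<open>The value \<open>u z\<close> exceeds \<open>Re (h z)\<close> by more than 2
    \<eta>. One \<eta> pays for the perturbation, which is at most \<eta> on \<Omega> by the choice
    of \<epsilon>; the other keeps the set \<open>K\<close> below away from the frontier.\<close>
  define \<eta> where "\<eta> = (q - Re (h z)) / 2"
  have "\<eta> > 0" using q by (simp add: \<eta>_def)
  obtain R where R: "\<And>x. x \<in> \<Omega> \<Longrightarrow> cmod x \<le> R" "R > 0"
    using \<Omega>(2) by (auto simp: bounded_pos)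
  define \<epsilon> where "\<epsilon> = \<eta> / R\<^sup>2"
  have "\<epsilon> > 0" using \<open>\<eta> > 0\<close> R by (simp add: \<epsilon>_def)
  define k where "k = (\<lambda>x. Re (h x) - \<epsilon> * (cmod x)\<^sup>2)"
  have k_le: "Re (h x) \<le> k x + \<eta>" if "x \<in> \<Omega>" for x
  proof -
    have "\<epsilon> * (cmod x)\<^sup>2 \<le> \<epsilon> * R\<^sup>2" using R(1)[OF that] \<open>\<epsilon> > 0\<close> by (intro mult_left_mono power_mono) auto
    then show ?thesis using R(2) by (simp add: k_def \<epsilon>_def)
  qed
  have k_le': "k x \<le> Re (h x)" for x using \<open>\<epsilon> > 0\<close> by (simp add: k_def)
  have ck: "continuous_on \<Omega> k" unfolding k_def
    by (intro continuous_intros holomorphic_on_imp_continuous_on[OF h(1)])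
  have fin: "u x < \<infinity>" if "x \<in> \<Omega>" for x using u that by (simp add: subharmonic_on_def)
  \<comment> \<open>Upper semicontinuity of u - k, phrased without a subtraction of extended
    reals.\<close>
  have usc: "\<exists>N. open N \<and> x \<in> N \<and> N \<subseteq> \<Omega> \<and> (\<forall>y\<in>N. u y < ereal (k y + c))"
    if x: "x \<in> \<Omega>" "u x < ereal (k x + c)" for x c
  proof -
    obtain q' where q': "u x < ereal q'" "q' < k x + c" using ereal_dense2[OF x(2)] by auto
    have "open {y \<in> \<Omega>. u y < ereal q'}"
      using u \<Omega>(1) by (auto simp: subharmonic_on_def openin_open_eq)
    moreover have "open {y \<in> \<Omega>. q' - c < k y}"
      using continuous_open_preimage[OF ck \<Omega>(1) open_greaterThan[of "q' - c"]]
      by (simp add: vimage_def Int_def)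
    ultimately have "open ({y \<in> \<Omega>. u y < ereal q'} \<inter> {y \<in> \<Omega>. q' - c < k y})" by blast
    moreover have "u y < ereal (k y + c)" if "u y < ereal q'" "q' - c < k y" for y
      using that by (metis ereal_less_eq(3) less_diff_eq diff_less_eq less_eq_real_def order_less_le_trans)
    ultimately show ?thesis using x q' by (intro exI[of _ "{y \<in> \<Omega>. u y < ereal q'} \<inter> {y \<in> \<Omega>. q' - c < k y}"]) auto
  qed
  \<comment> \<open>At the frontier u is asymptotically at most Re h <= k + \<eta>, strictly below k
    + 2 \<eta>. Hence \<open>K\<close> has no limit point there and is compact. On \<open>K\<close>
    the difference u - k is finite, so \<open>m\<close> represents it by a real number.\<close>
  define K where "K = {x \<in> \<Omega>. u x \<ge> ereal (k x + 2 * \<eta>)}"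
  have "K \<subseteq> \<Omega>" by (auto simp: K_def)
  have "\<exists>N. open N \<and> x \<in> N \<and> N \<subseteq> - K" if "x \<notin> K" for x
  proof -
    consider "x \<in> \<Omega>" | "x \<notin> closure \<Omega>" | "x \<in> frontier \<Omega>"
      using \<Omega>(1) by (auto simp: frontier_def interior_open)
    then show ?thesis
    proof cases
      case 1
      then have "u x < ereal (k x + 2 * \<eta>)" using that by (simp add: K_def)
      from usc[OF 1 this] obtain N where "open N" "x \<in> N" "N \<subseteq> \<Omega>" "\<forall>y\<in>N. u y < ereal (k y + 2 * \<eta>)" by blast
      then show ?thesis by (intro exI[of _ N]) (auto simp: K_def not_le)
    next
      case 2
      then show ?thesis using \<open>K \<subseteq> \<Omega>\<close> closure_subset by (intro exI[of _ "- closure \<Omega>"]) (auto simp: open_closed)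
    next
      case 3
      then have "x \<in> closure \<Omega>" by (simp add: frontier_def)
      have "Limsup (at x within \<Omega>) u < ereal (Re (h x) + \<eta> / 2)"
        by (rule order_le_less_trans[OF bd[OF 3]]) (use \<open>\<eta> > 0\<close> in simp)
      then have ev: "\<forall>\<^sub>F y in at x within \<Omega>. u y < ereal (Re (h x) + \<eta> / 2)" by (rule Limsup_lessD)
      have "((\<lambda>y. Re (h y)) \<longlongrightarrow> Re (h x)) (at x within \<Omega>)"
      proof (rule tendsto_Re)
        have "(h \<longlongrightarrow> h x) (at x within closure \<Omega>)"
          using h(2) \<open>x \<in> closure \<Omega>\<close> unfolding continuous_on_def by (rule bspec)
        then show "(h \<longlongrightarrow> h x) (at x within \<Omega>)"
          by (rule tendsto_within_subset) (rule closure_subset)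
      qed
      then have "\<forall>\<^sub>F y in at x within \<Omega>. Re (h x) - \<eta> / 2 < Re (h y)"
        using \<open>\<eta> > 0\<close> by (intro order_tendstoD(1)) auto
      with ev have "\<forall>\<^sub>F y in at x within \<Omega>. u y < ereal (k y + 2 * \<eta>)"
        unfolding eventually_at_filter
      proof eventually_elim
        case (elim y)
        show ?case
        proof (intro impI)
          assume y: "y \<noteq> x" "y \<in> \<Omega>"
          then have "u y < ereal (Re (h x) + \<eta> / 2)" "Re (h x) - \<eta> / 2 < Re (h y)" using elim by auto
          moreover have "Re (h x) + \<eta> / 2 \<le> k y + 2 * \<eta>" using k_le[OF y(2)] calculation(2) by simp
          ultimately show "u y < ereal (k y + 2 * \<eta>)" by (meson ereal_less_eq(3) order_less_le_trans)
        qed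
      qed
      then obtain N where "open N" "x \<in> N" "\<forall>y\<in>N. y \<noteq> x \<longrightarrow> y \<in> \<Omega> \<longrightarrow> u y < ereal (k y + 2 * \<eta>)"
        by (auto simp: eventually_at_topological)
      then show ?thesis using that by (intro exI[of _ N]) (auto simp: K_def not_le)
    qed
  qed
  then have "open (- K)" using open_subopen[of "- K"] by simp
  then have "compact K" using \<Omega>(2) \<open>K \<subseteq> \<Omega>\<close> bounded_subset by (auto simp: compact_eq_bounded_closed closed_def)
  have "k z + 2 * \<eta> \<le> q" using k_le'[of z] by (simp add: \<eta>_def field_simps)
  then have "ereal (k z + 2 * \<eta>) \<le> ereal q" by simp
  also have "\<dots> \<le> u z" using q(2) by (rule less_imp_le)
  finally have "z \<in> K" using z by (simp add: K_def)
  define m where "m = (\<lambda>x. real_of_ereal (u x) - k x)"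
  have m: "u x = ereal (k x + m x)" if "x \<in> K" for x
    using that fin[of x] by (cases "u x") (auto simp: m_def K_def)
  \<comment> \<open>An upper semicontinuous function attains its maximum on a compact set. Otherwise
    the open sets \<open>N w\<close>, on which u - k stays below \<open>m (s w)\<close>, have a
    finite subcover, and the point \<open>s d\<close> with the largest such value belongs to no
    member of it.\<close>
  have "\<exists>w\<in>K. \<forall>y\<in>K. m y \<le> m w"
  proof (rule ccontr)
    assume "\<not> ?thesis"
    then have "\<forall>w\<in>K. \<exists>y\<in>K. m w < m y" by (force simp: not_le)
    then obtain s where s: "\<And>w. w \<in> K \<Longrightarrow> s w \<in> K" "\<And>w. w \<in> K \<Longrightarrow> m w < m (s w)" by metis
    have "\<exists>N. open N \<and> w \<in> N \<and> N \<subseteq> \<Omega> \<and> (\<forall>y\<in>N. u y < ereal (k y + m (s w)))" if "w \<in> K" for w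
      using that \<open>K \<subseteq> \<Omega>\<close> s(2)[OF that] by (intro usc) (auto simp: m)
    then obtain N where N: "\<And>w. w \<in> K \<Longrightarrow> open (N w)" "\<And>w. w \<in> K \<Longrightarrow> w \<in> N w"
      "\<And>w y. w \<in> K \<Longrightarrow> y \<in> N w \<Longrightarrow> u y < ereal (k y + m (s w))" by metis
    obtain D where D: "D \<subseteq> K" "finite D" "K \<subseteq> (\<Union>w\<in>D. N w)"
      using compactE_image[OF \<open>compact K\<close>, of K N] N(1,2) by blast
    have "D \<noteq> {}" using D(3) \<open>z \<in> K\<close> by auto
    then obtain d where d: "d \<in> D" "m (s d) = Max ((\<lambda>w. m (s w)) ` D)"
      using Max_in[of "(\<lambda>w. m (s w)) ` D"] D(2) by fastforce
    then have "d \<in> D" "\<And>w. w \<in> D \<Longrightarrow> m (s w) \<le> m (s d)"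
      using D(2) by simp_all
    moreover have "s d \<in> K" using s(1) D(1) \<open>d \<in> D\<close> by auto
    then obtain w where "w \<in> D" "s d \<in> N w" using D(3) by auto
    then have "u (s d) < ereal (k (s d) + m (s w))" using N(3) D(1) by auto
    then have "m (s d) < m (s w)" using m[OF \<open>s d \<in> K\<close>] by simp
    ultimately show False using \<open>w \<in> D\<close> by force
  qed
  then obtain w where w: "w \<in> K" "\<And>y. y \<in> K \<Longrightarrow> m y \<le> m w" by blast
  have "w \<in> \<Omega>" using w(1) \<open>K \<subseteq> \<Omega>\<close> by auto
  have "m w \<ge> 2 * \<eta>" using w(1) m[OF w(1)] by (auto simp: K_def)
  have major: "u x \<le> ereal (k x + m w)" if "x \<in> \<Omega>" for x
  proof (cases "x \<in> K")
    case True
    then show ?thesis using w(2) m by simp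
  next
    case False
    then have "u x < ereal (k x + 2 * \<eta>)" using that by (simp add: K_def)
    also have "\<dots> \<le> ereal (k x + m w)" using \<open>m w \<ge> 2 * \<eta>\<close> by simp
    finally show ?thesis by simp
  qed
  obtain \<rho> where \<rho>: "\<rho> > 0" "ball w \<rho> \<subseteq> \<Omega>" "\<And>r. 0 < r \<Longrightarrow> r < \<rho> \<Longrightarrow> u w \<le> circle_mean u w r"
    using u \<open>w \<in> \<Omega>\<close> unfolding subharmonic_on_def by blast
  define r where "r = \<rho> / 2"
  have r: "0 < r" "r < \<rho>" using \<rho>(1) by (auto simp: r_def)
  have cb: "cball w r \<subseteq> \<Omega>" using \<rho>(2) r by auto
  have on: "w + of_real r * cis t \<in> cball w r" for t using r by (simp add: dist_norm norm_mult)
  \<comment> \<open>On the circle of radius \<open>r\<close> about \<open>w\<close>, the function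
    |x|^2 agrees with |w|^2 + r^2 plus twice the real part of (x - w) times the conjugate of w. So k
    + m w is there the real part of the holomorphic \<open>F\<close>, while at the centre
    \<open>Re (F w)\<close> is smaller than k w + m w by \<epsilon> r^2. The mean value property of
    \<open>F\<close> thus contradicts the submean inequality at \<open>w\<close>.\<close>
  define F where "F = (\<lambda>x. h x + of_real (m w - \<epsilon> * (cmod w)\<^sup>2 - \<epsilon> * r\<^sup>2) - 2 * of_real \<epsilon> * (x - w) * cnj w)"
  have F: "F holomorphic_on cball w r" unfolding F_def
    using cb by (intro holomorphic_intros holomorphic_on_subset[OF h(1)])
  have kF: "k (w + of_real r * cis t) + m w = Re (F (w + of_real r * cis t))" for t
  proof -
    have "(cmod (w + of_real r * cis t))\<^sup>2 = (cmod w)\<^sup>2 + r\<^sup>2 + 2 * Re (of_real r * cis t * cnj w)"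
    proof -
      have "r\<^sup>2 = (r * cos t)\<^sup>2 + (r * sin t)\<^sup>2"
        by (simp add: power_mult_distrib flip: distrib_left)
      then show ?thesis unfolding cmod_power2 by (simp add: power2_eq_square algebra_simps)
    qed
    then show ?thesis by (simp add: k_def F_def algebra_simps)
  qed
  have FI: "((\<lambda>t. Re (F (w + of_real r * cis t))) has_integral 2 * pi * Re (F w)) {0..2*pi}"
    by (rule has_integral_circle_mean_Re[OF F r(1)])
  have "u w \<le> circle_mean u w r" using \<rho>(3) r by blast
  also have "\<dots> \<le> circle_mean (\<lambda>x. ereal (Re (F x))) w r"
    using major cb on by (intro circle_mean_mono) (metis kF subsetD)
  also have "\<dots> = ereal (Re (F w))"
    by (subst circle_mean_ereal[OF _ FI]) (auto intro!: continuous_intros continuous_on_compose2[OF holomorphic_on_imp_continuous_on[OF F]] on simp del: mem_cball)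
  also have "Re (F w) = k w + m w - \<epsilon> * r\<^sup>2" by (simp add: F_def k_def)
  finally have "k w + m w \<le> k w + m w - \<epsilon> * r\<^sup>2" using m[OF w(1)] by simp
  then show False using \<open>\<epsilon> > 0\<close> r by (simp add: mult_le_0_iff)
qed

lemma Re_Poisson_kernel:
  "p \<noteq> z \<Longrightarrow> Re ((p + z) / (p - z)) = ((cmod p)\<^sup>2 - (cmod z)\<^sup>2) / (cmod (p - z))\<^sup>2"
proof -
  assume "p \<noteq> z"
  have "Re ((p + z) / (p - z)) = Re ((p + z) * cnj (p - z)) / (cmod (p - z))\<^sup>2"
    by (subst complex_div_cnj) (simp flip: of_real_power)
  also have "Re ((p + z) * cnj (p - z)) = (cmod p)\<^sup>2 - (cmod z)\<^sup>2"
    unfolding cmod_power2 by (simp add: power2_eq_square algebra_simps)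
  finally show ?thesis .
qed

section \<open>The upper bound for harmonic measure\<close>

lemma open_minus_level_set:
  assumes "\<psi> holomorphic_on ball 0 1"
  shows "open (ball 0 1 - level_set \<psi> a)"
proof -
  have "ball 0 1 - level_set \<psi> a = ball 0 1 \<inter> (\<lambda>z. cmod (\<psi> z)) -` (- {a})"
    by (auto simp: level_set_def)
  moreover have "open \<dots>"
    by (rule continuous_open_preimage[OF continuous_on_norm[OF holomorphic_on_imp_continuous_on[OF assms]]]) auto
  ultimately show ?thesis by simp
qed

text \<open>Each component lies within R = 50 \<delta> of a point of the unit circle. The Poisson
  kernel with pole at distance R outside that point, multiplied by 2R, is nonnegative on the closed
  disc, at least 1 on the component and equal to 2R at 0. The sum over all components majorizes the
  Perron class; placing the poles outside makes it continuous up to the boundary.\<close>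

lemma harmonic_measure_level_set_le:
  assumes f: "\<psi> holomorphic_on ball 0 1" and inj: "inj_on \<psi> (ball 0 1)" and "\<psi> 0 = 0" "a > 0"
    and \<delta>: "0 < \<delta>" "\<delta> < 1/64"
    and small: "\<And>z. cmod z \<le> 1 - \<delta> \<Longrightarrow> cmod (\<psi> z) \<le> a / 2"
    and fin: "finite (components (level_set \<psi> a))"
  shows "harmonic_measure (ball 0 1) 0 (level_set \<psi> a) \<le> ereal (100 * \<delta> * card (components (level_set \<psi> a)))"
proof -
  define F where "F = level_set \<psi> a"
  define \<Omega> where "\<Omega> = connected_component_set (ball 0 1 - F) 0"
  define R where "R = 50 * \<delta>"
  have R: "R > 0" using \<delta> by (simp add: R_def)
  have "\<exists>\<zeta>. cmod \<zeta> = 1 \<and> (\<forall>z\<in>C. cmod (z - \<zeta>) \<le> 50 * \<delta>)" if "C \<in> components F" for C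
  proof -
    have C: "connected C" "C \<subseteq> F" using in_components_connected[OF that] in_components_subset[OF that] by auto
    show ?thesis
      by (rule level_arc_near_boundary_point[OF f inj \<open>a > 0\<close> \<delta> small C(1)]) (use C(2) in \<open>auto simp: F_def level_set_def\<close>)
  qed
  then obtain \<zeta> where \<zeta>: "\<And>C. C \<in> components F \<Longrightarrow> cmod (\<zeta> C) = 1"
    "\<And>C z. C \<in> components F \<Longrightarrow> z \<in> C \<Longrightarrow> cmod (z - \<zeta> C) \<le> R"
    unfolding R_def by metis
  define p where "p = (\<lambda>C. of_real (1 + R) * \<zeta> C)"
  have np: "cmod (p C) = 1 + R" if "C \<in> components F" for C
    using \<zeta>(1)[OF that] R unfolding p_def norm_mult norm_of_real by simp
  define h where "h = (\<lambda>z. \<Sum>C\<in>components F. 2 * of_real R * ((p C + z) / (p C - z)))"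
  have neq: "p C \<noteq> z" if "C \<in> components F" "cmod z \<le> 1" for C z
    using np[OF that(1)] R that(2) by auto
  have Reh: "Re (h z) = (\<Sum>C\<in>components F. 2 * R * Re ((p C + z) / (p C - z)))" for z
  proof -
    have "Re (2 * of_real R * x) = 2 * R * Re x" for x by simp
    then show ?thesis unfolding h_def Re_sum by (intro sum.cong) (auto simp del: times_divide_eq_right)
  qed
  have nonneg: "0 \<le> 2 * R * Re ((p C + z) / (p C - z))" if "C \<in> components F" "cmod z \<le> 1" for C z
  proof -
    have "(cmod z)\<^sup>2 \<le> (cmod (p C))\<^sup>2" using np[OF that(1)] R that(2) by (intro power_mono) auto
    then show ?thesis using neq[OF that] R by (simp add: Re_Poisson_kernel)
  qed
  have h_ge_0: "0 \<le> Re (h z)" if "cmod z \<le> 1" for z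
    unfolding Reh using nonneg that by (intro sum_nonneg) auto
  have h_ge_1: "1 \<le> Re (h z)" if "z \<in> F" for z
  proof -
    have z: "cmod z < 1" using that by (auto simp: F_def level_set_def)
    have "z \<in> \<Union>(components F)" using that by simp
    then obtain C where C: "C \<in> components F" "z \<in> C" by (rule UnionE)
    have "cmod (p C - \<zeta> C) = R"
    proof -
      have "p C - \<zeta> C = of_real R * \<zeta> C" by (simp add: p_def algebra_simps)
      then show ?thesis using \<zeta>(1)[OF C(1)] R by (simp add: norm_mult)
    qed
    \<comment> \<open>The distance is at most R from the pole to \<open>\<zeta> C\<close> and at
      most R from there to \<open>z\<close>. The numerator of the kernel is at least 2R, so the
      kernel is at least 2R / (2R)^2, which explains the factor 2R in \<open>h\<close>.\<close>
    then have "cmod (p C - z) \<le> 2 * R"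
      using \<zeta>(2)[OF C] norm_triangle_ineq[of "p C - \<zeta> C" "\<zeta> C - z"] by (simp add: norm_minus_commute)
    then have "(cmod (p C - z))\<^sup>2 \<le> (2 * R)\<^sup>2" by (intro power_mono) auto
    moreover have "(cmod z)\<^sup>2 \<le> 1" using z by (simp add: power_le_one)
    moreover have "(cmod (p C))\<^sup>2 = 1 + 2 * R + R\<^sup>2" by (simp add: np[OF C(1)] power2_eq_square algebra_simps)
    moreover have "R\<^sup>2 \<ge> 0" by simp
    moreover have "cmod (p C - z) > 0" using neq[OF C(1), of z] z by simp
    ultimately have N: "2 * R \<le> (cmod (p C))\<^sup>2 - (cmod z)\<^sup>2" and "(cmod (p C - z))\<^sup>2 \<le> (2 * R)\<^sup>2"
      by linarith+
    note this(2)
    also have "(2 * R)\<^sup>2 = 2 * R * (2 * R)" by (rule power2_eq_square)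
    also have "\<dots> \<le> 2 * R * ((cmod (p C))\<^sup>2 - (cmod z)\<^sup>2)"
      using N R by (intro mult_left_mono) auto
    finally have "(cmod (p C - z))\<^sup>2 \<le> 2 * R * ((cmod (p C))\<^sup>2 - (cmod z)\<^sup>2)" .
    then have "1 \<le> 2 * R * Re ((p C + z) / (p C - z))"
      using neq[OF C(1), of z] z by (simp add: Re_Poisson_kernel)
    also have "\<dots> \<le> Re (h z)" unfolding Reh
      using C(1) fin nonneg z by (intro member_le_sum) (auto simp: F_def)
    finally show ?thesis .
  qed
  have \<Omega>_sub: "\<Omega> \<subseteq> ball 0 1 - F" unfolding \<Omega>_def by (rule connected_component_subset)
  have cl: "closure \<Omega> \<subseteq> cball 0 1" using \<Omega>_sub by (intro closure_minimal) auto
  have "0 \<in> \<Omega>" using assms by (simp add: \<Omega>_def F_def level_set_def)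
  have "open \<Omega>" unfolding \<Omega>_def F_def by (intro open_connected_component open_minus_level_set f)
  have "bounded \<Omega>" using \<Omega>_sub bounded_subset[OF bounded_ball] by blast
  have hol: "h holomorphic_on \<Omega>" unfolding h_def
    using \<Omega>_sub neq by (intro holomorphic_intros) fastforce
  have cont: "continuous_on (closure \<Omega>) h" unfolding h_def
    using cl neq by (intro continuous_intros) (auto simp: subset_iff)
  have "u 0 \<le> ereal (Re (h 0))" if "u \<in> perron_class \<Omega> (indicator F)" for u
  proof (rule subharmonic_le_Re_holomorphic[OF \<open>open \<Omega>\<close> \<open>bounded \<Omega>\<close> _ hol cont _ \<open>0 \<in> \<Omega>\<close>])
    show "subharmonic_on u \<Omega>" using that by (simp add: perron_class_def)
    fix \<zeta> assume \<zeta>: "\<zeta> \<in> frontier \<Omega>"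
    then have "Limsup (at \<zeta> within \<Omega>) u \<le> ereal (indicator F \<zeta>)" using that by (simp add: perron_class_def)
    also have "indicator F \<zeta> \<le> Re (h \<zeta>)"
      using h_ge_1[of \<zeta>] h_ge_0[of \<zeta>] \<zeta> cl by (auto simp: indicator_def frontier_def)
    finally show "Limsup (at \<zeta> within \<Omega>) u \<le> ereal (Re (h \<zeta>))" by simp
  qed
  moreover have "Re (h 0) = 100 * \<delta> * card (components F)"
  proof -
    have "Re (h 0) = (\<Sum>C\<in>components F. 2 * R)"
      unfolding Reh using neq[of _ 0] by (intro sum.cong) auto
    then show ?thesis by (simp add: R_def)
  qed
  ultimately show ?thesis
    unfolding harmonic_measure_def perron_solution_def F_def[symmetric] \<Omega>_def[symmetric]
    by (auto intro!: SUP_least)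
qed

section \<open>The lower bound for harmonic measure\<close>

lemma one_minus_cnj_mult_nonzero:
  assumes "cmod c < 1" "cmod z \<le> 1"
  shows "1 - cnj c * z \<noteq> 0"
proof
  assume "1 - cnj c * z = 0"
  then have "cmod (cnj c * z) = 1" by (metis eq_iff_diff_eq_0 norm_one)
  moreover have "cmod (cnj c * z) \<le> cmod c * 1"
    using assms unfolding norm_mult complex_mod_cnj by (intro mult_left_mono) auto
  ultimately show False using assms by simp
qed

text \<open>Written as the real part of a holomorphic function of \<open>w\<close>, the kernel
  inherits the mean value property under composition. The quotient form in
  \<open>poisson_altdef\<close> serves the estimates.\<close>

definition poisson :: "complex \<Rightarrow> real \<Rightarrow> real" where
  "poisson w \<theta> = Re ((cis \<theta> + w) / (cis \<theta> - w))"

text \<open>The harmonic measure of the set \<open>cis ` B\<close> in the unit disc. The value \<open>0\<close> outside the disc makes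
  it continuous away from \<open>cis ` B\<close>.\<close>

definition arc_measure :: "real set \<Rightarrow> complex \<Rightarrow> real" where
  "arc_measure B w = (if cmod w < 1 then (\<integral>\<theta>. indicator B \<theta> *\<^sub>R poisson w \<theta> \<partial>lborel) / (2 * pi) else 0)"

lemma poisson_altdef: "cmod w < 1 \<Longrightarrow> poisson w \<theta> = (1 - (cmod w)\<^sup>2) / (cmod (cis \<theta> - w))\<^sup>2"
  unfolding poisson_def by (subst Re_Poisson_kernel) auto

lemma poisson_nonneg: "cmod w < 1 \<Longrightarrow> 0 \<le> poisson w \<theta>"
  by (simp add: poisson_altdef power_le_one)

lemma continuous_on_poisson:
  assumes "continuous_on X g" "continuous_on X h" "\<And>x. x \<in> X \<Longrightarrow> cmod (g x) < 1"
  shows "continuous_on X (\<lambda>x. poisson (g x) (h x))"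
proof -
  have "cis (h x) - g x \<noteq> 0" if "x \<in> X" for x using assms(3)[OF that] norm_cis[of "h x"] by (metis eq_iff_diff_eq_0 less_irrefl)
  then show ?thesis unfolding poisson_def using assms(1,2) by (intro continuous_intros) auto
qed

text \<open>On the unit circle the quotient defining the kernel is the conjugate of (1 + cnj w z) /
  (1 - cnj w z). That function of z is holomorphic on the closed disc with value 1 at 0, so its mean
  is 1.\<close>

lemma has_integral_poisson:
  assumes "cmod w < 1"
  shows "(poisson w has_integral (2 * pi)) {0..2*pi}"
proof -
  have "(\<lambda>z. (1 + cnj w * z) / (1 - cnj w * z)) holomorphic_on cball 0 1"
    using one_minus_cnj_mult_nonzero[OF assms] by (intro holomorphic_intros) (auto simp: dist_norm)
  from has_integral_circle_mean_Re[OF this zero_less_one]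
  have "((\<lambda>t. Re ((1 + cnj w * cis t) / (1 - cnj w * cis t))) has_integral 2 * pi) {0..2*pi}"
    by (simp add: comp_def)
  moreover have "Re ((1 + cnj w * cis t) / (1 - cnj w * cis t)) = poisson w t" for t
  proof -
    have e: "cis t * cnj (cis t) = 1" by (simp add: cis_cnj cis_mult)
    have n: "cnj (cis t) \<noteq> 0" by simp
    have "cnj ((cis t + w) / (cis t - w)) = (cnj (cis t) + cnj w) / (cnj (cis t) - cnj w)" by simp
    also have "\<dots> = (cis t * (cnj (cis t) + cnj w)) / (cis t * (cnj (cis t) - cnj w))" by simp
    also have "\<dots> = (1 + cnj w * cis t) / (1 - cnj w * cis t)"
      unfolding distrib_left right_diff_distrib e by (simp add: mult.commute)
    finally show ?thesis by (metis poisson_def complex_cnj(1) cnj.simps(1))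
  qed
  ultimately show ?thesis by simp
qed

context
  fixes B :: "real set"
  assumes B: "compact B" "B \<subseteq> {0..2*pi}"
begin

lemma integrable_poisson: "cmod w < 1 \<Longrightarrow> integrable lborel (\<lambda>\<theta>. indicator B \<theta> *\<^sub>R poisson w \<theta>)"
  by (intro borel_integrable_compact B continuous_on_poisson) auto

lemma arc_measure_nonneg: "0 \<le> arc_measure B w"
  unfolding arc_measure_def using poisson_nonneg by (auto intro!: integral_nonneg_AE)

lemma arc_measure_le_1: "arc_measure B w \<le> 1"
proof (cases "cmod w < 1")
  case True
  have i: "integrable lborel (\<lambda>\<theta>. indicator {0..2*pi} \<theta> *\<^sub>R poisson w \<theta>)"
    using True by (intro borel_integrable_compact continuous_on_poisson) auto
  have "(\<integral>\<theta>. indicator B \<theta> *\<^sub>R poisson w \<theta> \<partial>lborel) \<le> (\<integral>\<theta>. indicator {0..2*pi} \<theta> *\<^sub>R poisson w \<theta> \<partial>lborel)"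
    using poisson_nonneg[OF True] B(2) by (intro integral_mono integrable_poisson True i) (auto simp: indicator_def)
  also have "\<dots> = integral {0..2*pi} (poisson w)"
    using set_borel_integral_eq_integral(2)[of "{0..2*pi}" "poisson w"] i
    by (simp add: set_integrable_def set_lebesgue_integral_def)
  also have "\<dots> = 2 * pi" by (rule integral_unique[OF has_integral_poisson[OF True]])
  finally show ?thesis using True by (simp add: arc_measure_def)
qed (simp add: arc_measure_def)

text \<open>Harnack's lower bound for the kernel, integrated over \<open>B\<close>.\<close>

lemma arc_measure_ge:
  assumes w: "cmod w < 1"
  shows "(1 - cmod w) / (1 + cmod w) * measure lborel B / (2 * pi) \<le> arc_measure B w"
proof -
  have P: "(1 - cmod w) / (1 + cmod w) \<le> poisson w \<theta>" for \<theta>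
  proof -
    have pos: "0 < cmod (cis \<theta> - w)" using w by auto
    have "cmod (cis \<theta> - w) \<le> 1 + cmod w" using norm_triangle_ineq4[of "cis \<theta>" w] by simp
    then have "(cmod (cis \<theta> - w))\<^sup>2 \<le> (1 + cmod w)\<^sup>2" by (intro power_mono) auto
    then have "(1 - (cmod w)\<^sup>2) / (1 + cmod w)\<^sup>2 \<le> poisson w \<theta>" unfolding poisson_altdef[OF w]
      using pos w by (intro divide_left_mono mult_pos_pos zero_less_power add_pos_nonneg) (auto simp: power_le_one)
    moreover have "(1 - (cmod w)\<^sup>2) / (1 + cmod w)\<^sup>2 = (1 - cmod w) / (1 + cmod w)"
    proof -
      have "1 - (cmod w)\<^sup>2 = (1 - cmod w) * (1 + cmod w)" by (simp add: power2_eq_square algebra_simps)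
      moreover have "1 + cmod w \<noteq> 0" using norm_ge_zero[of w] by linarith
      ultimately show ?thesis by (simp add: power2_eq_square)
    qed
    ultimately show ?thesis by simp
  qed
  have "(1 - cmod w) / (1 + cmod w) * measure lborel B = (\<integral>\<theta>. indicator B \<theta> *\<^sub>R ((1 - cmod w) / (1 + cmod w)) \<partial>lborel)"
    using B by simp
  also have "\<dots> \<le> (\<integral>\<theta>. indicator B \<theta> *\<^sub>R poisson w \<theta> \<partial>lborel)"
    using P by (intro integral_mono integrable_poisson w borel_integrable_compact B) (auto simp: indicator_def)
  finally have "(1 - cmod w) / (1 + cmod w) * measure lborel B / (2 * pi)
      \<le> (\<integral>\<theta>. indicator B \<theta> *\<^sub>R poisson w \<theta> \<partial>lborel) / (2 * pi)"
    by (rule divide_right_mono) simp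
  then show ?thesis using w by (simp only: arc_measure_def if_True)
qed

text \<open>The difference of the two quotients is 2 cis \<theta> (w - w') divided by factors of
  modulus at least 1 - \<rho>, uniformly in \<theta>. The length 2 pi of the interval cancels
  against the normalization.\<close>

lemma arc_measure_lipschitz:
  assumes "cmod w \<le> \<rho>" "cmod w' \<le> \<rho>" "\<rho> < 1"
  shows "\<bar>arc_measure B w - arc_measure B w'\<bar> \<le> 2 / (1 - \<rho>)\<^sup>2 * cmod (w - w')"
proof -
  have w: "cmod w < 1" "cmod w' < 1" using assms by auto
  have P: "\<bar>poisson w \<theta> - poisson w' \<theta>\<bar> \<le> 2 / (1 - \<rho>)\<^sup>2 * cmod (w - w')" for \<theta>
  proof -
    have ge: "1 - \<rho> \<le> cmod (cis \<theta> - v)" if "cmod v \<le> \<rho>" for v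
      using norm_triangle_ineq2[of "cis \<theta>" v] that by simp
    have ne: "cis \<theta> - w \<noteq> 0" "cis \<theta> - w' \<noteq> 0" using w by auto
    have "\<bar>poisson w \<theta> - poisson w' \<theta>\<bar> \<le> cmod ((cis \<theta> + w) / (cis \<theta> - w) - (cis \<theta> + w') / (cis \<theta> - w'))"
      unfolding poisson_def minus_complex.sel(1)[symmetric] by (rule abs_Re_le_cmod)
    also have "(cis \<theta> + w) / (cis \<theta> - w) - (cis \<theta> + w') / (cis \<theta> - w') = 2 * cis \<theta> * (w - w') / ((cis \<theta> - w) * (cis \<theta> - w'))"
      using ne by (simp add: divide_simps) (simp add: algebra_simps)
    also have "cmod \<dots> = 2 * cmod (w - w') / (cmod (cis \<theta> - w) * cmod (cis \<theta> - w'))"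
      by (simp add: norm_mult norm_divide)
    also have "\<dots> \<le> 2 * cmod (w - w') / ((1 - \<rho>) * (1 - \<rho>))"
      using ge assms ne by (intro divide_left_mono mult_mono) auto
    finally show ?thesis by (simp add: power2_eq_square)
  qed
  define c where "c = 2 / (1 - \<rho>)\<^sup>2 * cmod (w - w')"
  have "c \<ge> 0" by (simp add: c_def)
  have i: "integrable lborel (\<lambda>\<theta>. indicator {0..2*pi} \<theta> *\<^sub>R c)"
    by (intro borel_integrable_compact) auto
  have "\<bar>(\<integral>\<theta>. indicator B \<theta> *\<^sub>R poisson w \<theta> \<partial>lborel) - (\<integral>\<theta>. indicator B \<theta> *\<^sub>R poisson w' \<theta> \<partial>lborel)\<bar>
     = norm (\<integral>\<theta>. indicator B \<theta> *\<^sub>R poisson w \<theta> - indicator B \<theta> *\<^sub>R poisson w' \<theta> \<partial>lborel)"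
    by (subst Bochner_Integration.integral_diff) (auto intro!: integrable_poisson w simp del: real_scaleR_def)
  also have "\<dots> \<le> (\<integral>\<theta>. indicator {0..2*pi} \<theta> *\<^sub>R c \<partial>lborel)"
    using P B(2) \<open>c \<ge> 0\<close>
    by (intro Bochner_Integration.integral_norm_bound_integral Bochner_Integration.integrable_diff integrable_poisson w i) (auto simp: indicator_def c_def)
  also have "\<dots> = 2 * pi * c" by simp
  finally have "\<bar>(\<integral>\<theta>. indicator B \<theta> *\<^sub>R poisson w \<theta> \<partial>lborel) - (\<integral>\<theta>. indicator B \<theta> *\<^sub>R poisson w' \<theta> \<partial>lborel)\<bar> / (2 * pi) \<le> c"
    by (simp add: divide_le_eq mult_ac)
  moreover have "arc_measure B w - arc_measure B w' =
      ((\<integral>\<theta>. indicator B \<theta> *\<^sub>R poisson w \<theta> \<partial>lborel) - (\<integral>\<theta>. indicator B \<theta> *\<^sub>R poisson w' \<theta> \<partial>lborel)) / (2 * pi)"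
    using w by (simp add: arc_measure_def diff_divide_distrib)
  ultimately show ?thesis unfolding c_def[symmetric] by (simp add: abs_divide)
qed

lemma isCont_arc_measure_inside:
  assumes w: "cmod w < 1"
  shows "isCont (arc_measure B) w"
proof -
  obtain \<rho> where \<rho>: "cmod w < \<rho>" "\<rho> < 1" using dense[OF w] by blast
  have "((\<lambda>v. 2 / (1 - \<rho>)\<^sup>2 * cmod (v - w)) \<longlongrightarrow> 2 / (1 - \<rho>)\<^sup>2 * cmod (w - w)) (at w)"
    by (intro tendsto_intros)
  then have lim: "((\<lambda>v. 2 / (1 - \<rho>)\<^sup>2 * cmod (v - w)) \<longlongrightarrow> 0) (at w)" by simp
  have "\<forall>\<^sub>F v in at w. cmod v < \<rho>"
    by (rule order_tendstoD(2)[OF _ \<rho>(1)]) (intro tendsto_intros)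
  then have "\<forall>\<^sub>F v in at w. norm (arc_measure B v - arc_measure B w) \<le> 2 / (1 - \<rho>)\<^sup>2 * cmod (v - w)"
    by eventually_elim (use \<rho> arc_measure_lipschitz[of _ \<rho> w] in auto)
  from Lim_null_comparison[OF this lim] show ?thesis unfolding isCont_def by (subst Lim_null)
qed

text \<open>Near a point \<open>w\<close> at distance at least \<open>e\<close> from the set
  carrying the boundary values, the denominator of the kernel is at least (e/2)^2. Its numerator 1 -
  |v|^2 is at most 2 |v - w|, because |w| >= 1. So the Poisson integral tends to 0 and matches the
  extension by 0.\<close>

lemma isCont_arc_measure_outside:
  assumes w: "cmod w \<ge> 1" "w \<notin> cis ` B"
  shows "isCont (arc_measure B) w"
proof -
  have "compact (cis ` B)" by (intro compact_continuous_image B continuous_intros)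
  then have "open (- cis ` B)" by (simp add: compact_imp_closed open_Compl)
  then obtain e where e: "e > 0" "ball w e \<subseteq> - cis ` B" using w(2) open_contains_ball by blast
  then have far: "e \<le> cmod (cis \<theta> - w)" if "\<theta> \<in> B" for \<theta>
    using that by (force simp: dist_norm norm_minus_commute subset_iff not_less[symmetric])
  have near: "norm (arc_measure B v) \<le> 8 / e\<^sup>2 * cmod (v - w)" if v: "cmod (v - w) < e / 2" for v
  proof (cases "cmod v < 1")
    case True
    have c: "1 - (cmod v)\<^sup>2 \<le> 2 * cmod (v - w)"
    proof -
      have "1 - (cmod v)\<^sup>2 = (1 - cmod v) * (1 + cmod v)" by (simp add: power2_eq_square algebra_simps)
      also have "\<dots> \<le> (1 - cmod v) * 2" using True by (intro mult_left_mono) auto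
      also have "1 - cmod v \<le> cmod (v - w)" using w(1) norm_triangle_ineq2[of w v] by (simp add: norm_minus_commute)
      finally show ?thesis by simp
    qed
    have P: "poisson v \<theta> \<le> 8 / e\<^sup>2 * cmod (v - w)" if "\<theta> \<in> B" for \<theta>
    proof -
      have "e / 2 \<le> cmod (cis \<theta> - v)" using far[OF that] v norm_triangle_ineq[of "cis \<theta> - v" "v - w"] by simp
      then have "(e/2)\<^sup>2 \<le> (cmod (cis \<theta> - v))\<^sup>2" using e(1) by (intro power_mono) auto
      moreover have "0 < (e/2)\<^sup>2" using e(1) by simp
      ultimately have "poisson v \<theta> \<le> (2 * cmod (v - w)) / (e/2)\<^sup>2" unfolding poisson_altdef[OF True]
        using c by (intro frac_le) auto
      then show ?thesis by (simp add: power2_eq_square)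
    qed
    have "(\<integral>\<theta>. indicator B \<theta> *\<^sub>R poisson v \<theta> \<partial>lborel) \<le> (\<integral>\<theta>. indicator {0..2*pi} \<theta> *\<^sub>R (8 / e\<^sup>2 * cmod (v - w)) \<partial>lborel)"
      using P B(2) e(1) by (intro integral_mono integrable_poisson True borel_integrable_compact) (auto simp: indicator_def)
    also have "\<dots> = 2 * pi * (8 / e\<^sup>2 * cmod (v - w))" by simp
    finally have "arc_measure B v \<le> 8 / e\<^sup>2 * cmod (v - w)" using True by (simp add: arc_measure_def field_simps)
    then show ?thesis using arc_measure_nonneg[of v] by simp
  qed (simp add: arc_measure_def)
  have 0: "arc_measure B w = 0" using w by (simp add: arc_measure_def)
  have "((\<lambda>v. 8 / e\<^sup>2 * cmod (v - w)) \<longlongrightarrow> 8 / e\<^sup>2 * cmod (w - w)) (at w)"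
    by (intro tendsto_intros)
  then have lim: "((\<lambda>v. 8 / e\<^sup>2 * cmod (v - w)) \<longlongrightarrow> 0) (at w)" by simp
  have "\<forall>\<^sub>F v in at w. cmod (v - w) < e / 2"
    using e(1) by (intro order_tendstoD(2)[of _ "cmod (w - w)"] tendsto_intros) auto
  then have "\<forall>\<^sub>F v in at w. norm (arc_measure B v) \<le> 8 / e\<^sup>2 * cmod (v - w)"
    by eventually_elim (rule near)
  from Lim_null_comparison[OF this lim] show ?thesis unfolding isCont_def 0 .
qed

text \<open>For each fixed \<theta> the kernel composed with \<open>g\<close> is the real part of a
  holomorphic function and has the mean value property; Fubini's theorem exchanges the circle mean
  with the integral over \<open>B\<close>.\<close>

lemma circle_mean_arc_measure:
  assumes g: "g holomorphic_on cball w r" "r > 0" and lt: "\<And>z. z \<in> cball w r \<Longrightarrow> cmod (g z) < 1"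
  shows "circle_mean (\<lambda>z. ereal (arc_measure B (g z))) w r = ereal (arc_measure B (g w))"
proof -
  have on: "w + of_real r * cis t \<in> cball w r" for t using g(2) by (simp add: dist_norm norm_mult)
  define G where "G = (\<lambda>t. g (w + of_real r * cis t))"
  have G1: "cmod (G t) < 1" for t using lt[OF on] by (simp add: G_def)
  have cG: "continuous_on X G" for X unfolding G_def
    by (rule continuous_on_compose2[OF holomorphic_on_imp_continuous_on[OF g(1)]]) (auto intro!: continuous_intros on simp del: mem_cball)
  have inner: "(\<integral>t. indicator {0..2*pi} t *\<^sub>R poisson (G t) \<theta> \<partial>lborel) = 2 * pi * poisson (g w) \<theta>" for \<theta>
  proof -
    have ne: "cis \<theta> - g z \<noteq> 0" if "z \<in> cball w r" for z using lt[OF that] norm_cis[of \<theta>] by (metis eq_iff_diff_eq_0 less_irrefl)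
    have "(\<lambda>z. (cis \<theta> + g z) / (cis \<theta> - g z)) holomorphic_on cball w r"
      using ne by (intro holomorphic_intros g) auto
    from has_integral_circle_mean_Re[OF this g(2)]
    have "((\<lambda>t. poisson (G t) \<theta>) has_integral 2 * pi * poisson (g w) \<theta>) {0..2*pi}"
      by (simp add: poisson_def G_def)
    moreover have "integrable lborel (\<lambda>t. indicator {0..2*pi} t *\<^sub>R poisson (G t) \<theta>)"
      using G1 cG by (intro borel_integrable_compact continuous_on_poisson) auto
    ultimately show ?thesis
      using set_borel_integral_eq_integral(2)[of "{0..2*pi}" "\<lambda>t. poisson (G t) \<theta>"]
      by (simp add: set_integrable_def set_lebesgue_integral_def integral_unique)
  qed
  have "integrable lborel (\<lambda>p. indicator ({0..2*pi} \<times> B) p *\<^sub>R poisson (G (fst p)) (snd p))"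
    using G1 by (intro borel_integrable_compact compact_Times B continuous_on_poisson continuous_intros
        continuous_on_compose2[OF cG]) auto
  then have int: "integrable (lborel \<Otimes>\<^sub>M lborel) (\<lambda>(t, \<theta>). indicator {0..2*pi} t *\<^sub>R (indicator B \<theta> *\<^sub>R poisson (G t) \<theta>))"
    by (simp add: lborel_prod case_prod_beta' indicator_times mult.assoc)
  have cont: "continuous_on {0..2*pi} (\<lambda>t. arc_measure B (G t))"
    by (rule continuous_on_compose2[OF _ cG, of "ball 0 1"])
      (use G1 isCont_arc_measure_inside in \<open>auto intro!: continuous_at_imp_continuous_on\<close>)
  have "integral {0..2*pi} (\<lambda>t. arc_measure B (G t)) = (\<integral>t. indicator {0..2*pi} t *\<^sub>R arc_measure B (G t) \<partial>lborel)"
    using set_borel_integral_eq_integral(2)[of "{0..2*pi}" "\<lambda>t. arc_measure B (G t)"] borel_integrable_compact[OF _ cont]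
    by (simp add: set_integrable_def set_lebesgue_integral_def)
  also have "\<dots> = (\<integral>t. (\<integral>\<theta>. indicator {0..2*pi} t *\<^sub>R (indicator B \<theta> *\<^sub>R poisson (G t) \<theta>) \<partial>lborel) \<partial>lborel) / (2 * pi)"
    using G1 by (simp add: arc_measure_def)
  also have "(\<integral>t. (\<integral>\<theta>. indicator {0..2*pi} t *\<^sub>R (indicator B \<theta> *\<^sub>R poisson (G t) \<theta>) \<partial>lborel) \<partial>lborel)
     = (\<integral>\<theta>. (\<integral>t. indicator {0..2*pi} t *\<^sub>R (indicator B \<theta> *\<^sub>R poisson (G t) \<theta>) \<partial>lborel) \<partial>lborel)"
    by (rule lborel_pair.Fubini_integral[symmetric]) (rule int)
  also have "\<dots> = (\<integral>\<theta>. indicator B \<theta> *\<^sub>R (2 * pi * poisson (g w) \<theta>) \<partial>lborel)"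
    unfolding inner[symmetric] by (rule Bochner_Integration.integral_cong) (auto simp: indicator_def)
  also have "\<dots> = 2 * pi * (\<integral>\<theta>. indicator B \<theta> *\<^sub>R poisson (g w) \<theta> \<partial>lborel)"
    by (simp add: mult_ac flip: integral_mult_right_zero)
  finally have "integral {0..2*pi} (\<lambda>t. arc_measure B (G t)) = 2 * pi * arc_measure B (g w)"
    using lt[of w] g(2) by (simp add: arc_measure_def)
  moreover have "(\<lambda>t. arc_measure B (G t)) integrable_on {0..2*pi}"
    using cont by (rule integrable_continuous_interval)
  ultimately have "((\<lambda>t. arc_measure B (G t)) has_integral (2 * pi * arc_measure B (g w))) {0..2*pi}"
    by (simp add: has_integral_integral)
  then show ?thesis
    using circle_mean_ereal[of "\<lambda>z. arc_measure B (g z)" w r "2 * pi * arc_measure B (g w)"] cont by (simp add: G_def)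
qed

end

section \<open>Square root of a Blaschke factor and the competitor in the Perron class\<close>

definition blaschke :: "complex \<Rightarrow> complex \<Rightarrow> complex" where
  "blaschke c z = (c - z) / (1 - cnj c * z)"

lemma blaschke_inj:
  assumes c: "cmod c < 1" and z: "cmod z \<le> 1" "cmod w \<le> 1" and eq: "blaschke c z = blaschke c w"
  shows "z = w"
proof -
  have "(c - z) * (1 - cnj c * w) = (c - w) * (1 - cnj c * z)"
    using eq one_minus_cnj_mult_nonzero[OF c z(1)] one_minus_cnj_mult_nonzero[OF c z(2)]
    by (simp add: blaschke_def frac_eq_eq)
  then have "(w - z) * (1 - c * cnj c) = 0" by (simp add: algebra_simps)
  moreover have "1 - c * cnj c \<noteq> 0" using one_minus_cnj_mult_nonzero[OF c, of c] c by (simp add: mult.commute)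
  ultimately show ?thesis by simp
qed

lemma norm_blaschke_circle:
  assumes c: "cmod c < 1" and z: "cmod z = 1"
  shows "cmod (blaschke c z) = 1"
proof -
  have "z * cnj z = 1" using z by (simp add: complex_norm_square[symmetric])
  then have "1 - cnj c * z = - z * cnj (c - z)" by (simp add: algebra_simps)
  then have "cmod (1 - cnj c * z) = cmod (c - z)" using z by (simp add: norm_mult flip: complex_cnj_diff)
  then show ?thesis using one_minus_cnj_mult_nonzero[OF c, of z] c z by (auto simp: blaschke_def norm_divide)
qed

text \<open>\<open>1 - f z / f c\<close> lies in the right half-plane wherever \<open>\<bar>f z\<bar> < \<bar>f c\<bar>\<close>, and its quotient by the
  Blaschke factor is zero-free on the whole disc; both have square roots, although the sublevel
  set need not be simply connected a priori.\<close>

lemma blaschke_sqrt_on_sublevel: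
  assumes f: "f holomorphic_on ball 0 1" and inj: "inj_on f (ball 0 1)" and c: "cmod c < 1" and fc: "f c \<noteq> 0"
  obtains s where "s holomorphic_on {z \<in> ball 0 1. cmod (f z) < cmod (f c)}"
    "\<And>z. z \<in> ball 0 1 \<Longrightarrow> cmod (f z) < cmod (f c) \<Longrightarrow> (s z)\<^sup>2 = blaschke c z"
proof -
  \<comment> \<open>The difference quotient of \<open>f\<close> at \<open>c\<close>, with its
    removable singularity filled in. Injectivity makes it zero-free: away from \<open>c\<close>
    directly, at \<open>c\<close> because an injective holomorphic function has nonvanishing
    derivative.\<close>
  define q where "q = (\<lambda>z. if z = c then deriv f c else (f z - f c) / (z - c))"
  have q: "q holomorphic_on ball 0 1" unfolding q_def by (rule pole_lemma_open[OF f open_ball])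
  have q0: "q z \<noteq> 0" if "z \<in> ball 0 1" for z
    using that inj_onD[OF inj, of z c] c holomorphic_injective_imp_regular[OF f open_ball inj, of c]
    by (auto simp: q_def)
  \<comment> \<open>Chosen so that 1 - f z / f c is the product of \<open>blaschke c z\<close> and
    \<open>Q z\<close>. A logarithm of \<open>Q\<close> exists on the whole disc, and
    \<open>s\<close> is the root of the left side divided by the root of \<open>Q\<close>.\<close>
  define Q where "Q = (\<lambda>z. (1 - cnj c * z) * q z / f c)"
  have Q: "Q holomorphic_on ball 0 1" unfolding Q_def using fc by (intro holomorphic_intros q) auto
  have Q0: "Q z \<noteq> 0" if "z \<in> ball 0 1" for z
    using q0[OF that] fc one_minus_cnj_mult_nonzero[OF c, of z] that by (simp add: Q_def)
  obtain l where l: "l holomorphic_on ball 0 1" "\<And>z. z \<in> ball 0 1 \<Longrightarrow> exp (l z) = Q z"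
    using holomorphic_logarithm_exists[OF convex_ball open_ball Q, of 0] Q0 by (metis centre_in_ball zero_less_one)
  define s where "s = (\<lambda>z. csqrt (1 - f z / f c) * exp (- l z / 2))"
  let ?U = "{z \<in> ball 0 1. cmod (f z) < cmod (f c)}"
  have half: "1 - f z / f c \<notin> \<real>\<^sub>\<le>\<^sub>0" if "z \<in> ?U" for z
  proof -
    have "Re (f z / f c) \<le> cmod (f z / f c)" by (rule complex_Re_le_cmod)
    also have "\<dots> < 1" using that fc by (simp add: norm_divide)
    finally show ?thesis by (auto simp: complex_nonpos_Reals_iff)
  qed
  have "s holomorphic_on ?U" unfolding s_def
    using half fc
    by (intro holomorphic_intros holomorphic_on_compose_gen[OF _ holomorphic_on_csqrt, unfolded comp_def]
        holomorphic_on_subset[OF f] holomorphic_on_subset[OF l(1)]) auto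
  moreover have "(s z)\<^sup>2 = blaschke c z" if "z \<in> ball 0 1" "cmod (f z) < cmod (f c)" for z
  proof -
    have "z \<noteq> c" using that by auto
    have "(s z)\<^sup>2 = (1 - f z / f c) * (exp (- l z / 2))\<^sup>2" by (simp add: s_def power_mult_distrib)
    also have "(exp (- l z / 2))\<^sup>2 = exp (- l z)" using exp_double[of "- l z / 2"] by simp
    also have "exp (- l z) = 1 / Q z" using l(2)[OF that(1)] by (simp add: exp_minus inverse_eq_divide)
    also have "(1 - f z / f c) * (1 / Q z) = blaschke c z"
    proof -
      define D E where "D = f z - f c" and "E = 1 - cnj c * z"
      have "D \<noteq> 0" using that by (auto simp: D_def)
      moreover have "E \<noteq> 0" using one_minus_cnj_mult_nonzero[OF c, of z] that(1) by (simp add: E_def)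
      moreover have "1 - f z / f c = - (D / f c)" using fc by (simp add: D_def diff_divide_distrib)
      moreover have "Q z = E * (D / (z - c)) / f c" using \<open>z \<noteq> c\<close> by (simp add: Q_def q_def D_def E_def)
      moreover have "blaschke c z = - ((z - c) / E)" unfolding blaschke_def E_def minus_divide_left by simp
      ultimately show ?thesis using fc \<open>z \<noteq> c\<close> by simp
    qed
    finally show ?thesis .
  qed
  ultimately show thesis by (rule that)
qed

text \<open>The part of \<open>B\<close> in the upper half of the range, shifted back by pi, covers
  together with the part in the lower half an interval of length pi. Translation invariance gives
  the bound.\<close>

lemma measure_ge_pi_of_antipodal_cover:
  assumes B: "B \<in> sets borel" "B \<subseteq> {0..2*pi}"
    and cover: "\<And>\<theta>. 0 \<le> \<theta> \<Longrightarrow> \<theta> \<le> pi \<Longrightarrow> \<theta> \<in> B \<or> \<theta> + pi \<in> B"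
  shows "pi \<le> measure lborel B"
proof -
  define B1 where "B1 = B \<inter> {0..<pi}"
  define B2 where "B2 = B \<inter> {pi..2*pi}"
  have fm: "X \<in> fmeasurable lborel" if "X \<in> sets borel" "X \<subseteq> {- 2*pi..2*pi}" for X :: "real set"
    by (rule fmeasurableI2[of "{- 2*pi..2*pi}"]) (use that in \<open>auto intro!: fmeasurable_compact\<close>)
  have meas: "B1 \<in> sets borel" "B2 \<in> sets borel" using B by (auto simp: B1_def B2_def)
  have shift: "measure lborel ((\<lambda>x. x + pi) -` B2) = measure lborel B2"
  proof -
    have "measure lborel B2 = measure (distr lborel borel (\<lambda>x. pi + 1 * x)) B2"
      using lborel_distr_plus[of pi] by simp
    also have "\<dots> = measure lborel ((\<lambda>x. x + pi) -` B2)"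
      by (subst measure_distr) (use meas in \<open>auto simp: add.commute vimage_def\<close>)
    finally show ?thesis by simp
  qed
  have m2: "(\<lambda>x. x + pi) -` B2 \<in> sets borel"
    using measurable_sets_borel[of "\<lambda>x. x + pi" borel B2] meas by simp
  have "pi = measure lborel {0..<pi}" by simp
  also have "\<dots> \<le> measure lborel (B1 \<union> (\<lambda>x. x + pi) -` B2)"
    using cover meas m2 by (intro measure_mono_fmeasurable fm) (force simp: B1_def B2_def)+
  also have "\<dots> \<le> measure lborel B1 + measure lborel ((\<lambda>x. x + pi) -` B2)"
    using meas m2 by (intro measure_Un_le) auto
  also have "\<dots> = measure lborel (B1 \<union> B2)"
    unfolding shift
  proof (rule measure_Union[symmetric])
    have "B1 \<in> fmeasurable lborel" "B2 \<in> fmeasurable lborel"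
      using meas B(2) by (auto intro!: fm simp: B1_def B2_def)
    then show "emeasure lborel B1 \<noteq> \<infinity>" "emeasure lborel B2 \<noteq> \<infinity>" by (auto dest: fmeasurableD2)
  qed (use meas in \<open>auto simp: B1_def B2_def\<close>)
  also have "B1 \<union> B2 = B" using B(2) by (auto simp: B1_def B2_def)
  finally show ?thesis .
qed

text \<open>The square root is what gives the right order: its image contains no two antipodal
  points, so at least half of every circle |w| = t is omitted. The Poisson integral of the omitted
  part, pulled back by \<open>s\<close>, is then a competitor whose value at 0 is bounded below by
  Harnack's inequality.\<close>

lemma harmonic_measure_level_set_ge:
  assumes f: "\<psi> holomorphic_on ball 0 1" and inj: "inj_on \<psi> (ball 0 1)" and "\<psi> 0 = 0" "a > 0"
    and c: "c \<in> level_set \<psi> a"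
  shows "ereal ((1 - sqrt (cmod c)) / 8) \<le> harmonic_measure (ball 0 1) 0 (level_set \<psi> a)"
proof -
  define F where "F = level_set \<psi> a"
  define \<Omega> where "\<Omega> = connected_component_set (ball 0 1 - F) 0"
  have c1: "cmod c < 1" "cmod (\<psi> c) = a" using c by (auto simp: level_set_def)
  have "c \<noteq> 0" "\<psi> c \<noteq> 0" using c1 assms(3,4) by auto
  have \<Omega>_sub: "\<Omega> \<subseteq> ball 0 1 - F" unfolding \<Omega>_def by (rule connected_component_subset)
  have \<Omega>1: "cmod z < 1" if "z \<in> \<Omega>" for z using \<Omega>_sub that by auto
  have "0 \<in> \<Omega>" using assms(3,4) by (simp add: \<Omega>_def F_def level_set_def)
  have "open \<Omega>" unfolding \<Omega>_def F_def by (intro open_connected_component open_minus_level_set f)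
  have conn: "connected \<Omega>" by (simp add: \<Omega>_def)
  \<comment> \<open>On the connected \<Omega> the modulus of \<psi> starts at 0 and never equals
    \<open>a\<close>, so it stays below \<open>a\<close>. This puts \<Omega> inside the domain of
    the square root.\<close>
  have \<Omega>_lt: "cmod (\<psi> z) < a" if "z \<in> \<Omega>" for z
  proof (rule ccontr)
    assume "\<not> cmod (\<psi> z) < a"
    have "connected ((\<lambda>z. cmod (\<psi> z)) ` \<Omega>)"
      using \<Omega>_sub by (intro connected_continuous_image conn continuous_on_norm
          continuous_on_subset[OF holomorphic_on_imp_continuous_on[OF f]]) auto
    then have "{cmod (\<psi> 0)..cmod (\<psi> z)} \<subseteq> (\<lambda>z. cmod (\<psi> z)) ` \<Omega>"
      by (rule connected_contains_Icc) (use \<open>0 \<in> \<Omega>\<close> that in auto)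
    then have "a \<in> (\<lambda>z. cmod (\<psi> z)) ` \<Omega>" using \<open>\<not> cmod (\<psi> z) < a\<close> assms(3,4) by auto
    then show False using \<Omega>_sub by (auto simp: F_def level_set_def)
  qed
  obtain s where s: "s holomorphic_on {z \<in> ball 0 1. cmod (\<psi> z) < a}"
    "\<And>z. z \<in> ball 0 1 \<Longrightarrow> cmod (\<psi> z) < a \<Longrightarrow> (s z)\<^sup>2 = blaschke c z"
    using blaschke_sqrt_on_sublevel[OF f inj c1(1) \<open>\<psi> c \<noteq> 0\<close>] unfolding c1(2) by blast
  have sh: "s holomorphic_on \<Omega>" using \<Omega>_sub \<Omega>_lt by (intro holomorphic_on_subset[OF s(1)]) auto
  have s2: "(s z)\<^sup>2 = blaschke c z" if "z \<in> \<Omega>" for z using s(2) \<Omega>_sub \<Omega>_lt that by auto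
  have s_inj: "z = w" if "z \<in> \<Omega>" "w \<in> \<Omega>" "(s z)\<^sup>2 = (s w)\<^sup>2" for z w
    using blaschke_inj[OF c1(1), of z w] that \<Omega>1[of z] \<Omega>1[of w] by (auto simp: s2)
  then have injs: "inj_on s \<Omega>" by (auto simp: inj_on_def)
  have s_nz: "s z \<noteq> 0" if "z \<in> \<Omega>" for z
  proof
    assume "s z = 0"
    then have "blaschke c z = 0" using s2[OF that] by simp
    then have "z = c" using one_minus_cnj_mult_nonzero[OF c1(1), of z] \<Omega>1[OF that] by (auto simp: blaschke_def)
    then show False using \<Omega>_lt[OF that] c1 by simp
  qed
  \<comment> \<open>Antipodal values have equal squares, so z = w and then \<open>s z\<close> = 0;
    but \<open>s\<close> has no zero on \<Omega>, since \<open>c\<close> lies on the level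
    set.\<close>
  have s_anti: "s z \<noteq> - s w" if "z \<in> \<Omega>" "w \<in> \<Omega>" for z w
    using s_inj[OF that] s_nz that by fastforce
  have oA: "open (s ` \<Omega>)" by (rule open_mapping_thm3[OF sh \<open>open \<Omega>\<close> injs])
  have norm_s: "cmod (s z) = sqrt (cmod (blaschke c z))" if "z \<in> \<Omega>" for z
    using s2[OF that] by (metis norm_ge_zero norm_power real_sqrt_unique)
  have s0: "cmod (s 0) = sqrt (cmod c)" using norm_s[OF \<open>0 \<in> \<Omega>\<close>] by (simp add: blaschke_def)
  define r where "r = sqrt (cmod c)"
  have r: "0 < r" "r < 1" using c1 \<open>c \<noteq> 0\<close> by (auto simp: r_def)
  \<comment> \<open>The radius must exceed r = |s 0| so that 0 is mapped inside the circle, and must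
    be below 1 so that the competitor vanishes near the unit circle. The midpoint keeps t - r
    comparable to 1 - r.\<close>
  define t where "t = (1 + r) / 2"
  have t: "0 < t" "t < 1" "r < t" using r by (auto simp: t_def)
  define B where "B = {\<theta> \<in> {0..2*pi}. of_real t * cis \<theta> \<notin> s ` \<Omega>}"
  have "closed B"
  proof -
    have "B = {0..2*pi} \<inter> (\<lambda>\<theta>. of_real t * cis \<theta>) -` (- s ` \<Omega>)" by (auto simp: B_def)
    moreover have "closed \<dots>" using oA by (intro continuous_closed_preimage continuous_intros) (auto simp: closed_def)
    ultimately show ?thesis by simp
  qed
  then have B: "compact B" "B \<subseteq> {0..2*pi}"
    by (auto simp: B_def compact_eq_bounded_closed intro: bounded_subset[OF bounded_closed_interval])
  have pi: "pi \<le> measure lborel B"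
  proof (rule measure_ge_pi_of_antipodal_cover)
    fix \<theta> assume \<theta>: "0 \<le> \<theta>" "\<theta> \<le> pi"
    show "\<theta> \<in> B \<or> \<theta> + pi \<in> B"
    proof (rule ccontr)
      assume "\<not> ?thesis"
      then obtain z w where "z \<in> \<Omega>" "w \<in> \<Omega>" "of_real t * cis \<theta> = s z" "of_real t * cis (\<theta> + pi) = s w"
        using \<theta> by (auto simp: B_def)
      moreover have "cis (\<theta> + pi) = - cis \<theta>" by (simp flip: cis_mult)
      ultimately show False using s_anti[of w z] by simp
    qed
  qed (use \<open>closed B\<close> B(2) in auto)
  define g where "g = (\<lambda>z. s z / of_real t)"
  define u where "u = (\<lambda>z. arc_measure B (g z))"
  have gh: "g holomorphic_on \<Omega>" unfolding g_def using t by (intro holomorphic_intros sh) auto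
  have ng: "cmod (g z) = cmod (s z) / t" for z using t by (simp add: g_def norm_divide)
  have contu: "continuous_on \<Omega> u"
  proof -
    have "isCont (arc_measure B) (g z)" if "z \<in> \<Omega>" for z
    proof (cases "cmod (g z) < 1")
      case True
      then show ?thesis by (rule isCont_arc_measure_inside[OF B])
    next
      case False
      \<comment> \<open>By definition \<open>B\<close> consists of angles omitted by the image of
        \<Omega>. Hence wherever |g| >= 1 on \<Omega> the extension by 0 is continuous, even across
        the circle |g| = 1.\<close>
      have "g z \<notin> cis ` B"
      proof
        assume "g z \<in> cis ` B"
        then obtain \<theta> where "\<theta> \<in> B" "g z = cis \<theta>" by auto
        then have "s z = of_real t * cis \<theta>" using t by (simp add: g_def field_simps)
        then have "of_real t * cis \<theta> \<in> s ` \<Omega>" using that by (metis imageI)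
        then show False using \<open>\<theta> \<in> B\<close> by (simp add: B_def)
      qed
      then show ?thesis using False by (intro isCont_arc_measure_outside[OF B]) auto
    qed
    then have "continuous_on (g ` \<Omega>) (arc_measure B)" by (auto intro!: continuous_at_imp_continuous_on)
    then show ?thesis unfolding u_def
      by (rule continuous_on_compose2[OF _ holomorphic_on_imp_continuous_on[OF gh]]) auto
  qed
  have u_nonneg: "0 \<le> u z" and u_le_1: "u z \<le> 1" for z
    unfolding u_def by (rule arc_measure_nonneg[OF B] arc_measure_le_1[OF B])+
  have sub: "subharmonic_on (\<lambda>z. ereal (u z)) \<Omega>"
    unfolding subharmonic_on_def
  proof (intro conjI ballI allI)
    fix e :: ereal
    have "openin (top_of_set \<Omega>) (\<Omega> \<inter> (\<lambda>z. ereal (u z)) -` {..<e})"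
      by (rule continuous_openin_preimage_gen[OF _ open_lessThan]) (intro continuous_on_ereal contu)
    then show "openin (top_of_set \<Omega>) {z \<in> \<Omega>. ereal (u z) < e}" by (simp add: vimage_def Int_def)
  next
    fix w assume w: "w \<in> \<Omega>"
    show "\<exists>\<rho>>0. ball w \<rho> \<subseteq> \<Omega> \<and> (\<forall>r. 0 < r \<and> r < \<rho> \<longrightarrow> ereal (u w) \<le> circle_mean (\<lambda>z. ereal (u z)) w r)"
    proof (cases "cmod (g w) < 1")
      case True
      have "open (\<Omega> \<inter> (\<lambda>z. cmod (g z)) -` {..<1})"
        by (rule continuous_open_preimage[OF continuous_on_norm[OF holomorphic_on_imp_continuous_on[OF gh]] \<open>open \<Omega>\<close> open_lessThan])
      then obtain \<rho> where \<rho>: "\<rho> > 0" "ball w \<rho> \<subseteq> \<Omega> \<inter> (\<lambda>z. cmod (g z)) -` {..<1}"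
        using True w open_contains_ball by (metis IntI lessThan_iff vimageI2)
      have "ereal (u w) \<le> circle_mean (\<lambda>z. ereal (u z)) w r" if "0 < r" "r < \<rho>" for r
      proof -
        have cb: "cball w r \<subseteq> \<Omega> \<inter> (\<lambda>z. cmod (g z)) -` {..<1}" using \<rho>(2) that by auto
        then have "circle_mean (\<lambda>z. ereal (arc_measure B (g z))) w r = ereal (arc_measure B (g w))"
          using that(1) by (intro circle_mean_arc_measure[OF B] holomorphic_on_subset[OF gh]) auto
        then show ?thesis by (simp add: u_def)
      qed
      then show ?thesis using \<rho> by auto
    next
      case False
      \<comment> \<open>Where u vanishes, the submean inequality only says that the circle mean of
        the nonnegative u is nonnegative.\<close>
      then have "u w = 0" by (simp add: u_def arc_measure_def)
      have "0 \<le> circle_mean (\<lambda>z. ereal (u z)) w r" for r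
      proof -
        have "circle_mean (\<lambda>z. ereal 0) w r = ereal (0 / (2 * pi))"
          by (rule circle_mean_ereal) auto
        then show ?thesis using circle_mean_mono[of "\<lambda>z. ereal 0" w r "\<lambda>z. ereal (u z)"] u_nonneg
          by (simp add: zero_ereal_def)
      qed
      moreover obtain \<rho> where "\<rho> > 0" "ball w \<rho> \<subseteq> \<Omega>" using \<open>open \<Omega>\<close> w open_contains_ball by blast
      ultimately show ?thesis using \<open>u w = 0\<close> by (auto simp: zero_ereal_def)
    qed
  qed auto
  have bd: "Limsup (at \<zeta> within \<Omega>) (\<lambda>z. ereal (u z)) \<le> ereal (indicator F \<zeta>)" if \<zeta>: "\<zeta> \<in> frontier \<Omega>" for \<zeta>
  proof (cases "\<zeta> \<in> F")
    case True
    then show ?thesis using u_le_1 by (intro Limsup_bounded always_eventually) simp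
  next
    case False
    have "\<zeta> \<in> closure \<Omega>" "\<zeta> \<notin> \<Omega>" using \<zeta> \<open>open \<Omega>\<close> by (auto simp: frontier_def interior_open)
    moreover have "closure \<Omega> \<subseteq> cball 0 1" using \<Omega>_sub by (intro closure_minimal) auto
    ultimately have "cmod \<zeta> \<le> 1" by auto
    \<comment> \<open>A frontier point inside the disc and off \<open>F\<close> would have a disc
      around it in the complement of \<open>F\<close>; joined to \<Omega>, this disc would enlarge
      the connected component.\<close>
    moreover have "\<not> cmod \<zeta> < 1"
    proof
      assume "cmod \<zeta> < 1"
      then have mem: "\<zeta> \<in> ball 0 1 - F" using False by simp
      then obtain e where e: "e > 0" "ball \<zeta> e \<subseteq> ball 0 1 - F"
        using open_minus_level_set[OF f, of a] open_contains_ball unfolding F_def by blast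
      obtain y where y: "y \<in> \<Omega>" "dist y \<zeta> < e" using \<open>\<zeta> \<in> closure \<Omega>\<close> e(1) closure_approachable by blast
      have "connected (\<Omega> \<union> ball \<zeta> e)"
        using y by (intro connected_Un conn) (auto simp: dist_commute)
      then have "\<Omega> \<union> ball \<zeta> e \<subseteq> connected_component_set (ball 0 1 - F) 0"
        using \<open>0 \<in> \<Omega>\<close> e(2) \<Omega>_sub by (intro connected_component_maximal) auto
      then have "\<zeta> \<in> \<Omega>" using centre_in_ball[of \<zeta> e] e(1) unfolding \<Omega>_def by blast
      then show False using \<open>\<zeta> \<notin> \<Omega>\<close> by simp
    qed
    ultimately have \<zeta>1: "cmod \<zeta> = 1" by simp
    \<comment> \<open>The Blaschke factor has modulus 1 on the unit circle, so |s| > t near \<zeta>,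
      and there u is 0.\<close>
    have "isCont (blaschke c) \<zeta>" unfolding blaschke_def[abs_def]
      using one_minus_cnj_mult_nonzero[OF c1(1), of \<zeta>] \<zeta>1 by (intro continuous_intros) auto
    then have "((\<lambda>z. sqrt (cmod (blaschke c z))) \<longlongrightarrow> sqrt (cmod (blaschke c \<zeta>))) (at \<zeta> within \<Omega>)"
      by (intro tendsto_intros) (simp add: continuous_at_imp_continuous_at_within continuous_within[symmetric])
    then have "\<forall>\<^sub>F z in at \<zeta> within \<Omega>. t < sqrt (cmod (blaschke c z))"
      using t(2) by (intro order_tendstoD(1)) (auto simp: norm_blaschke_circle[OF c1(1) \<zeta>1])
    then have "\<forall>\<^sub>F z in at \<zeta> within \<Omega>. ereal (u z) \<le> ereal (indicator F \<zeta>)"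
      unfolding eventually_at_filter
    proof eventually_elim
      case (elim z)
      show ?case
      proof (intro impI)
        assume "z \<noteq> \<zeta>" "z \<in> \<Omega>"
        then have "t < cmod (s z)" using elim norm_s by simp
        then have "\<not> cmod (g z) < 1" using t(1) by (simp add: ng)
        then have "u z = 0" by (simp add: u_def arc_measure_def)
        then show "ereal (u z) \<le> ereal (indicator F \<zeta>)" by (simp add: indicator_def)
      qed
    qed
    then show ?thesis by (rule Limsup_bounded)
  qed
  have "(\<lambda>z. ereal (u z)) \<in> perron_class \<Omega> (indicator F)"
    unfolding perron_class_def using sub bd u_le_1 by auto
  then have "ereal (u 0) \<le> perron_solution \<Omega> (indicator F) 0"
    unfolding perron_solution_def by (rule SUP_upper)
  moreover have "(1 - r) / 8 \<le> u 0"
  proof -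
    have g0: "cmod (g 0) = r / t" by (simp add: ng s0 r_def)
    then have lt: "cmod (g 0) < 1" using t by simp
    \<comment> \<open>The quotient equals (t - r) / (t + r), with t - r = (1 - r)/2 and t + r <= 2.
      The last factor 1/2 is the share of the circle that \<open>B\<close> is known to
      occupy.\<close>
    have "(1 - r) / 8 \<le> (1 - r / t) / (1 + r / t) / 2"
    proof -
      have "1 - r / t = (t - r) / t" "1 + r / t = (t + r) / t" using t by (simp_all add: diff_divide_distrib add_divide_distrib)
      then have "(1 - r / t) / (1 + r / t) = (t - r) / (t + r)" using t by simp
      also have "(t - r) = (1 - r) / 2" by (simp add: t_def field_simps)
      also have "(1 - r) / 2 / (t + r) \<ge> (1 - r) / 2 / 2" using t r by (intro divide_left_mono) auto
      finally have "(1 - r) / 2 / 2 / 2 \<le> (1 - r / t) / (1 + r / t) / 2"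
        by (rule divide_right_mono) simp
      then show ?thesis by simp
    qed
    also have "\<dots> = (1 - r / t) / (1 + r / t) * pi / (2 * pi)" by simp
    also have "\<dots> \<le> (1 - r / t) / (1 + r / t) * measure lborel B / (2 * pi)"
      using pi t r by (intro divide_right_mono mult_left_mono) auto
    also have "\<dots> \<le> u 0" unfolding u_def using arc_measure_ge[OF B lt] by (simp add: g0)
    finally show ?thesis .
  qed
  then have "ereal ((1 - sqrt (cmod c)) / 8) \<le> ereal (u 0)" by (simp add: r_def)
  ultimately show ?thesis
    unfolding harmonic_measure_def F_def[symmetric] \<Omega>_def[symmetric] by (rule order_trans[rotated])
qed

section \<open>Comparison on the logarithmic scale\<close>

text \<open>If the modulus of \<psi> exceeded \<alpha> at a point no farther from 0 than
  \<open>c\<close>, the intermediate value theorem on the radius to that point would give a point of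
  the level set closer to 0.\<close>

lemma level_set_nearest_point:
  assumes f: "\<psi> holomorphic_on ball 0 1" and "\<psi> 0 = 0" "\<alpha> > 0" and ne: "level_set \<psi> \<alpha> \<noteq> {}"
  obtains c where "c \<in> level_set \<psi> \<alpha>" "\<And>z. z \<in> level_set \<psi> \<alpha> \<Longrightarrow> cmod c \<le> cmod z"
    "\<And>z. cmod z \<le> cmod c \<Longrightarrow> cmod (\<psi> z) \<le> \<alpha>"
proof -
  obtain z1 where z1: "cmod z1 < 1" "cmod (\<psi> z1) = \<alpha>" using ne by (auto simp: level_set_def)
  \<comment> \<open>The level set is closed only relative to the open disc. Intersecting it with the
    closed disc through one of its points gives a compact set that contains every candidate for the
    minimum.\<close>
  define K where "K = cball 0 (cmod z1) \<inter> (\<lambda>z. cmod (\<psi> z)) -` {\<alpha>}"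
  have contn: "continuous_on X (\<lambda>z. cmod (\<psi> z))" if "X \<subseteq> ball 0 1" for X
    using that by (intro continuous_on_norm continuous_on_subset[OF holomorphic_on_imp_continuous_on[OF f]])
  have "compact K"
    unfolding K_def compact_eq_bounded_closed using z1
    by (auto intro!: continuous_closed_preimage contn intro: bounded_subset[OF bounded_cball])
  moreover have "z1 \<in> K" using z1 by (simp add: K_def)
  ultimately obtain c where c: "c \<in> K" "\<And>z. z \<in> K \<Longrightarrow> cmod c \<le> cmod z"
    using continuous_attains_inf[of K cmod] continuous_on_norm[OF continuous_on_id[of K]] by blast
  have c1: "cmod c < 1" "cmod (\<psi> c) = \<alpha>" "cmod c \<le> cmod z1" using c(1) z1 by (auto simp: K_def)
  have min: "cmod c \<le> cmod z" if "z \<in> level_set \<psi> \<alpha>" for z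
    using c(2)[of z] that c1(3) by (cases "cmod z \<le> cmod z1") (auto simp: K_def level_set_def)
  have "cmod (\<psi> z) \<le> \<alpha>" if z: "cmod z \<le> cmod c" for z
  proof (rule ccontr)
    assume "\<not> cmod (\<psi> z) \<le> \<alpha>"
    then have gt: "\<alpha> < cmod (\<psi> z)" by simp
    have sub: "{of_real t * z | t. t \<in> {0..1}} \<subseteq> cball 0 (cmod z)"
      by (auto simp: norm_mult mult_left_le_one_le)
    have "continuous_on {0..1} (\<lambda>t. cmod (\<psi> (of_real t * z)))"
      by (rule continuous_on_compose2[OF contn[of "cball 0 (cmod z)"]])
        (use sub z c1 in \<open>auto intro!: continuous_intros simp: norm_mult mult_left_le_one_le\<close>)
    then obtain t where t: "0 \<le> t" "t \<le> 1" "cmod (\<psi> (of_real t * z)) = \<alpha>"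
      using IVT'[of "\<lambda>t. cmod (\<psi> (of_real t * z))" 0 \<alpha> 1] gt assms(2,3) by auto
    have "t \<noteq> 1" using t(3) gt by auto
    have "z \<noteq> 0" using gt assms(2,3) by auto
    have nt: "cmod (of_real t * z) = t * cmod z" using t(1) by (simp add: norm_mult)
    also have "\<dots> < cmod z" using t(2) \<open>t \<noteq> 1\<close> \<open>z \<noteq> 0\<close> by simp
    finally have lt: "cmod (of_real t * z) < cmod z" .
    then have "of_real t * z \<in> level_set \<psi> \<alpha>" using t(3) z c1(1) by (simp add: level_set_def)
    from min[OF this] show False using lt z by simp
  qed
  moreover have "c \<in> level_set \<psi> \<alpha>" using c1 by (simp add: level_set_def)
  ultimately show thesis using min by (intro that) auto
qed

lemma hyp_setdist_eq:
  assumes c: "c \<in> E" "\<And>z. z \<in> E \<Longrightarrow> cmod c \<le> cmod z" and E: "E \<subseteq> ball 0 1"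
  shows "hyp_setdist 0 E = ereal (ln ((1 + cmod c) / (1 - cmod c)))"
proof -
  have "(1 + cmod c) / (1 - cmod c) \<le> (1 + cmod w) / (1 - cmod w)" if "w \<in> E" for w
    using c(2)[OF that] that E c(1) by (intro frac_le) auto
  moreover have "0 < (1 + cmod c) / (1 - cmod c)" using c(1) E by (auto intro!: divide_pos_pos add_pos_nonneg)
  ultimately have "hyp_dist 0 c \<le> hyp_dist 0 w" if "w \<in> E" for w
    using that unfolding hyp_dist_def
    by (simp, subst ln_le_cancel_iff) (auto intro: order.strict_trans2)
  then have "hyp_setdist 0 E = ereal (hyp_dist 0 c)"
    unfolding hyp_setdist_def using c(1) by (intro INF_eqI) auto
  then show ?thesis by (simp add: hyp_dist_def)
qed

lemma exp_minus_hyp_dist_bounds: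
  assumes "0 \<le> r" "r < (1::real)"
  shows "exp (- ln ((1 + r) / (1 - r))) \<le> 1 - r" "1 - r \<le> 2 * exp (- ln ((1 + r) / (1 - r)))"
proof -
  have "exp (- ln ((1 + r) / (1 - r))) = (1 - r) / (1 + r)"
    using assms by (simp add: exp_minus)
  then show "exp (- ln ((1 + r) / (1 - r))) \<le> 1 - r" "1 - r \<le> 2 * exp (- ln ((1 + r) / (1 - r)))"
    using assms mult_left_mono[of "1 + r" 2 "1 - r"] by (simp_all add: divide_le_eq le_divide_eq)
qed

text \<open>The conventions for the logarithm do the work: infinitely many components give the
  quotient \<infinity>, none gives -\<infinity>, and the two bounds exclude both.\<close>

lemma finite_components_if_ln_bounded:
  assumes "- 1 < ereal_ln (ereal_of_enat (num_components S)) / ereal b"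
    "ereal_ln (ereal_of_enat (num_components S)) / ereal b < 1" "b > 0"
  shows "finite (components S)" "components S \<noteq> {}"
    "ereal_ln (ereal_of_enat (num_components S)) = ereal (ln (card (components S)))"
proof -
  show fin: "finite (components S)"
  proof (rule ccontr)
    assume "infinite (components S)"
    then show False using assms by (simp add: num_components_def ereal_ln_def)
  qed
  show ne: "components S \<noteq> {}"
  proof
    assume "components S = {}"
    then show False using assms by (simp add: num_components_def ereal_ln_def)
  qed
  show "ereal_ln (ereal_of_enat (num_components S)) = ereal (ln (card (components S)))"
    using fin ne by (simp add: num_components_def ereal_ln_def card_gt_0_iff)
qed

theorem corollary1p2:
  fixes \<psi> :: "complex \<Rightarrow> complex" and L :: ereal
  assumes "conformal_map \<psi>" and "\<psi> 0 = 0"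
    and "0 \<le> L"
    and "((\<lambda>\<alpha>::real. ereal_ln (inverse (harmonic_measure (ball 0 1) 0 (level_set \<psi> \<alpha>)))
            / ereal (ln \<alpha>)) \<longlongrightarrow> L) at_top"
    and "((\<lambda>\<alpha>::real. ereal_ln (ereal_of_enat (num_components (level_set \<psi> \<alpha>)))
            / ereal (ln \<alpha>)) \<longlongrightarrow> 0) at_top"
  shows "\<exists>\<mu>::ereal. 0 \<le> \<mu> \<and>
           ((\<lambda>\<alpha>::real. hyp_setdist 0 (level_set \<psi> \<alpha>) / ereal (ln \<alpha>)) \<longlongrightarrow> \<mu>) at_top \<and>
           \<mu> = L"
proof -
  have f: "\<psi> holomorphic_on ball 0 1" and inj: "inj_on \<psi> (ball 0 1)"
    using assms(1) by (auto simp: conformal_map_def)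
  define F where "F = level_set \<psi>"
  define W where "W = (\<lambda>\<alpha>. harmonic_measure (ball 0 1) 0 (F \<alpha>))"
  define n where "n = (\<lambda>\<alpha>. real (card (components (F \<alpha>))))"
  define X where "X = (\<lambda>\<alpha>. ereal_ln (inverse (W \<alpha>)))"
  define D where "D = (\<lambda>\<alpha>. hyp_setdist 0 (F \<alpha>))"
  \<comment> \<open>The limit 0 of the quotient forces finitely many, and at least one, component at
    all high levels; in particular the level sets are nonempty.\<close>
  have comp: "\<forall>\<^sub>F \<alpha> in at_top. finite (components (F \<alpha>)) \<and> components (F \<alpha>) \<noteq> {} \<and>
      ereal_ln (ereal_of_enat (num_components (F \<alpha>))) = ereal (ln (n \<alpha>))"
  proof -
    have "\<forall>\<^sub>F \<alpha> in at_top. -1 < ereal_ln (ereal_of_enat (num_components (F \<alpha>))) / ereal (ln \<alpha>)"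
      "\<forall>\<^sub>F \<alpha> in at_top. ereal_ln (ereal_of_enat (num_components (F \<alpha>))) / ereal (ln \<alpha>) < 1"
      unfolding F_def using assms(5) by (intro order_tendstoD[OF assms(5)]; simp)+
    then show ?thesis using eventually_gt_at_top[of 1]
    proof eventually_elim
      case (elim \<alpha>)
      then show ?case
        using finite_components_if_ln_bounded[of "F \<alpha>" "ln \<alpha>"] unfolding n_def by simp
    qed
  qed
  \<comment> \<open>For \<alpha> > M the level set stays outside the disc of radius 63/64, so that
    \<delta> = 1 - r satisfies the requirement \<delta> < 1/64.\<close>
  obtain M where M: "\<And>z. cmod z \<le> 63/64 \<Longrightarrow> cmod (\<psi> z) \<le> M"
  proof -
    have "compact (\<psi> ` cball 0 (63/64))"
      by (intro compact_continuous_image continuous_on_subset[OF holomorphic_on_imp_continuous_on[OF f]]) auto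
    then have "bounded (\<psi> ` cball 0 (63/64))" by (rule compact_imp_bounded)
    then obtain b where "\<forall>x\<in>\<psi> ` cball 0 (63/64). cmod x \<le> b" unfolding bounded_iff by blast
    then show thesis by (intro that[of b]) auto
  qed
  \<comment> \<open>The upper bound is taken at level 2 \<alpha>, because it requires the modulus of
    \<psi> to be at most half the level on the disc of radius 1 - \<delta>, and on the disc of
    radius r it is known to be at most \<alpha>. Both bounds thus involve the same distance
    d.\<close>
  have low: "\<exists>d. D \<alpha> = ereal d \<and> ereal (exp (- d) / 16) \<le> W \<alpha> \<and>
      (finite (components (F (2 * \<alpha>))) \<longrightarrow> W (2 * \<alpha>) \<le> ereal (200 * n (2 * \<alpha>) * exp (- d)))"
    if nonempty: "F \<alpha> \<noteq> {}" and large: "\<alpha> > max M 0" for \<alpha>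
  proof -
    have "\<alpha> > 0" using large by simp
    obtain c where c: "c \<in> F \<alpha>" "\<And>z. z \<in> F \<alpha> \<Longrightarrow> cmod c \<le> cmod z"
      and small: "\<And>z. cmod z \<le> cmod c \<Longrightarrow> cmod (\<psi> z) \<le> \<alpha>"
      using level_set_nearest_point[OF f \<open>\<psi> 0 = 0\<close> \<open>\<alpha> > 0\<close> nonempty[unfolded F_def]] unfolding F_def by blast
    define r where "r = cmod c"
    have r: "0 \<le> r" "r < 1" using c(1) by (auto simp: r_def F_def level_set_def)
    have "\<not> r \<le> 63/64" using M[of c] c(1) large by (auto simp: r_def F_def level_set_def)
    define d where "d = ln ((1 + r) / (1 - r))"
    have "D \<alpha> = ereal d" unfolding D_def d_def r_def
      by (rule hyp_setdist_eq[OF c]) (auto simp: F_def level_set_def)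
    moreover have "ereal (exp (- d) / 16) \<le> W \<alpha>"
    proof -
      \<comment> \<open>This gives 1 - sqrt r >= (1 - r)/2, which turns the constant 8 into
        16.\<close>
      have "sqrt r \<le> (1 + r) / 2" using arith_geo_mean_sqrt[of 1 r] r by simp
      then have "exp (- d) / 16 \<le> (1 - sqrt r) / 8"
        using exp_minus_hyp_dist_bounds(1)[OF r] by (simp add: d_def field_simps)
      then show ?thesis
        using harmonic_measure_level_set_ge[OF f inj \<open>\<psi> 0 = 0\<close> \<open>\<alpha> > 0\<close>, of c] c(1)
        unfolding W_def F_def r_def by (meson ereal_less_eq(3) order_trans)
    qed
    moreover have "W (2 * \<alpha>) \<le> ereal (200 * n (2 * \<alpha>) * exp (- d))" if "finite (components (F (2 * \<alpha>)))"
    proof -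
      have "W (2 * \<alpha>) \<le> ereal (100 * (1 - r) * n (2 * \<alpha>))"
        unfolding W_def n_def F_def
      proof (rule harmonic_measure_level_set_le[OF f inj \<open>\<psi> 0 = 0\<close>])
        show "finite (components (level_set \<psi> (2 * \<alpha>)))" using that by (simp add: F_def)
      qed (use \<open>\<alpha> > 0\<close> r \<open>\<not> r \<le> 63/64\<close> small in \<open>auto simp: r_def\<close>)
      also have "100 * (1 - r) * n (2 * \<alpha>) \<le> 100 * (2 * exp (- d)) * n (2 * \<alpha>)"
        using exp_minus_hyp_dist_bounds(2)[OF r] by (intro mult_right_mono mult_left_mono) (auto simp: d_def n_def)
      finally show ?thesis by (simp add: mult_ac)
    qed
    ultimately show ?thesis by blast
  qed
  have fin2: "filterlim (\<lambda>\<alpha>. 2 * \<alpha> :: real) at_top at_top" "filterlim (\<lambda>\<alpha>. \<alpha> / 2 :: real) at_top at_top"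
    by real_asymp+
  have ne: "F \<alpha> \<noteq> {}" if "components (F \<alpha>) \<noteq> {}" for \<alpha> using that by auto
  have est: "\<forall>\<^sub>F \<alpha> in at_top. \<exists>d. D \<alpha> = ereal d \<and> ereal (exp (- d) / 16) \<le> W \<alpha> \<and>
      W (2 * \<alpha>) \<le> ereal (200 * n (2 * \<alpha>) * exp (- d)) \<and> n (2 * \<alpha>) \<ge> 1"
    using comp eventually_compose_filterlim[OF comp fin2(1)] eventually_gt_at_top[of "max M 0"]
  proof eventually_elim
    case (elim \<alpha>)
    then have "n (2 * \<alpha>) \<ge> 1" by (simp add: n_def Suc_le_eq card_gt_0_iff)
    then show ?case using low[of \<alpha>] ne[of \<alpha>] elim by blast
  qed
  \<comment> \<open>The lower bound at \<alpha> shows that \<open>W \<alpha>\<close> is positive,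
    and the upper bound obtained from level \<alpha>/2 shows that it is finite, so
    \<open>ereal_ln\<close> reduces to the real logarithm.\<close>
  have X: "\<forall>\<^sub>F \<alpha> in at_top. \<exists>w. 0 < w \<and> W \<alpha> = ereal w \<and> X \<alpha> = ereal (- ln w)"
    using est eventually_compose_filterlim[OF est fin2(2)]
  proof eventually_elim
    case (elim \<alpha>)
    then obtain d d' where d: "ereal (exp (- d) / 16) \<le> W \<alpha>"
      and d': "W (2 * (\<alpha> / 2)) \<le> ereal (200 * n (2 * (\<alpha> / 2)) * exp (- d'))" by blast
    from d d' obtain w where w: "W \<alpha> = ereal w" by (cases "W \<alpha>") auto
    moreover have "exp (- d) / 16 \<le> w" using d w by simp
    moreover have "0 < exp (- d) / 16" by simp
    ultimately have "0 < w" by linarith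
    then show ?case using w by (auto simp: X_def ereal_ln_def ln_inverse)
  qed
  \<comment> \<open>Logarithms of the two bounds. The upper one concerns level 2 \<alpha>, where the
    hypotheses normalize by ln (2 \<alpha>); the last factor converts this to the normalization by
    ln \<alpha>.\<close>
  have sandwich: "\<forall>\<^sub>F \<alpha> in at_top. X \<alpha> / ereal (ln \<alpha>) + ereal (- ln 16 / ln \<alpha>) \<le> D \<alpha> / ereal (ln \<alpha>) \<and>
     D \<alpha> / ereal (ln \<alpha>) \<le> (X (2 * \<alpha>) / ereal (ln (2 * \<alpha>)) + (ereal (ln 200 / ln (2 * \<alpha>)) +
        ereal (ln (n (2 * \<alpha>))) / ereal (ln (2 * \<alpha>)))) * ereal (ln (2 * \<alpha>) / ln \<alpha>)"
    using est X eventually_compose_filterlim[OF X fin2(1)] eventually_gt_at_top[of 1]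
  proof eventually_elim
    case (elim \<alpha>)
    then obtain d w w' where d: "D \<alpha> = ereal d" "ereal (exp (- d) / 16) \<le> W \<alpha>"
      "W (2 * \<alpha>) \<le> ereal (200 * n (2 * \<alpha>) * exp (- d))" "n (2 * \<alpha>) \<ge> 1"
      and w: "0 < w" "W \<alpha> = ereal w" "X \<alpha> = ereal (- ln w)"
      and w': "0 < w'" "W (2 * \<alpha>) = ereal w'" "X (2 * \<alpha>) = ereal (- ln w')" by blast
    have l: "ln \<alpha> > 0" "ln (2 * \<alpha>) > 0" using elim by auto
    have "ln (exp (- d) / 16) \<le> ln w" using d w by simp
    then have 1: "- ln w - ln 16 \<le> d" by (simp add: ln_div)
    have "ln w' \<le> ln (200 * n (2 * \<alpha>) * exp (- d))" using d w' by simp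
    also have "\<dots> = ln 200 + ln (n (2 * \<alpha>)) - d" using d(4) by (simp add: ln_mult)
    finally have 2: "d \<le> - ln w' + ln 200 + ln (n (2 * \<alpha>))" by simp
    show ?case using 1 2 l
      by (simp add: d(1) w(3) w'(3) flip: add_divide_distrib) (simp add: divide_simps)
  qed
  have lim1: "((\<lambda>\<alpha>. X \<alpha> / ereal (ln \<alpha>) + ereal (- ln 16 / ln \<alpha>)) \<longlongrightarrow> L + ereal 0) at_top"
    using assms(4) unfolding X_def W_def F_def by (intro tendsto_add_ereal_general) (auto, real_asymp)
  \<comment> \<open>The limit L may be \<infinity>. The other summands tend to 0 and the factor
    tends to 1, so extended real addition and multiplication are continuous at the limits.\<close>
  have lim2: "((\<lambda>\<alpha>. (X (2 * \<alpha>) / ereal (ln (2 * \<alpha>)) + (ereal (ln 200 / ln (2 * \<alpha>)) +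
        ereal (ln (n (2 * \<alpha>))) / ereal (ln (2 * \<alpha>)))) * ereal (ln (2 * \<alpha>) / ln \<alpha>)) \<longlongrightarrow> (L + (ereal 0 + 0)) * ereal 1) at_top"
  proof (intro tendsto_mult_ereal tendsto_add_ereal_general)
    show "((\<lambda>\<alpha>. X (2 * \<alpha>) / ereal (ln (2 * \<alpha>))) \<longlongrightarrow> L) at_top"
      using filterlim_compose[OF assms(4) fin2(1)] by (simp add: X_def W_def F_def)
    have "((\<lambda>\<alpha>. ereal (ln (n \<alpha>)) / ereal (ln \<alpha>)) \<longlongrightarrow> 0) at_top"
      using assms(5) by (rule Lim_transform_eventually)
        (use comp in \<open>eventually_elim, simp add: F_def\<close>)
    from filterlim_compose[OF this fin2(1)]
    show "((\<lambda>\<alpha>. ereal (ln (n (2 * \<alpha>))) / ereal (ln (2 * \<alpha>))) \<longlongrightarrow> 0) at_top" .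
    show "((\<lambda>\<alpha>::real. ereal (ln 200 / ln (2 * \<alpha>))) \<longlongrightarrow> ereal 0) at_top"
      by (intro tendsto_ereal) real_asymp
    show "((\<lambda>\<alpha>::real. ereal (ln (2 * \<alpha>) / ln \<alpha>)) \<longlongrightarrow> ereal 1) at_top"
      by (intro tendsto_ereal) real_asymp
  qed auto
  have "((\<lambda>\<alpha>. D \<alpha> / ereal (ln \<alpha>)) \<longlongrightarrow> L) at_top"
    using sandwich lim1 lim2
    by (intro tendsto_sandwich[of "\<lambda>\<alpha>. X \<alpha> / ereal (ln \<alpha>) + ereal (- ln 16 / ln \<alpha>)" "\<lambda>\<alpha>. D \<alpha> / ereal (ln \<alpha>)" at_top
      "\<lambda>\<alpha>. (X (2 * \<alpha>) / ereal (ln (2 * \<alpha>)) + (ereal (ln 200 / ln (2 * \<alpha>)) +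
        ereal (ln (n (2 * \<alpha>))) / ereal (ln (2 * \<alpha>)))) * ereal (ln (2 * \<alpha>) / ln \<alpha>)" L])
      (auto simp: eventually_conj_iff one_ereal_def[symmetric])
  then show ?thesis using \<open>0 \<le> L\<close> by (auto simp: D_def F_def)
qed

end
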